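(* Let $X$ be a set and $\Omega$ a nonempty set. With respect to the monomial order $\leq_{\mathrm{db}}$ on $\mathfrak{M}(\Omega_R\sqcup\Omega_S,X)$: (a) the set $\mathbb{S}_{MS}$ consisting of all elements $$\lfloor u\rfloor^R_\alpha\lfloor v\rfloor^R_\beta-\big\lfloor\lfloor u\rfloor^R_\alpha v\big\rfloor^R_{\beta}-\big\lfloor u\lfloor v\rfloor^S_\beta\big\rfloor^R_{\alpha},\qquad \lfloor u\rfloor^S_\alpha\lfloor v\rfloor^S_\beta-\big\lfloor\lfloor u\rfloor^R_\alpha v\big\rfloor^S_{\beta}-\big\lfloor u\lfloor v\rfloor^S_\beta\big\rfloor^S_{\alpha},$$ with $u,v\in\mathfrak{M}(\Omega_R\sqcup\Omega_S,X)$ and $\alpha,\beta\in\Omega$, is a Gröbner-Shirshov basis in $\mathbf{k}\mathfrak{M}(\Omega_R\sqcup\Omega_S,X)$; (b) the set $$\mathrm{Irr}(\mathbb{S}_{MS})=\{w\in\mathfrak{M}(\Omega_R\sqcup\Omega_S,X)\mid w\neq q|_{\overline{s}}\text{ for any }q\in\mathfrak{M}^\star(\Omega_R\sqcup\Omega_S,X)\text{ and any }s\in\mathbb{S}_{MS}\}$$ is a $\mathbf{k}$-basis of the free matching Rota-Baxter system $\mathbf{k}\mathfrak{M}(\Omega_R\sqcup\Omega_S,X)/\mathrm{Id}(\mathbb{S}_{MS})$ on $X$.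
   Context: $\mathbf{k}$ is a fixed commutative unitary ring; algebras are unitary associative $\mathbf{k}$-algebras. **Matching Rota-Baxter system.** For a set $\Omega$, this is an algebra $A$ with linear operators $R_\omega,S_\omega:A\to A$ ($\omega\in\Omega$) such that for all $a,b\in A$, $\alpha,\beta\in\Omega$: $R_\alpha(a)R_\beta(b)=R_\beta(R_\alpha(a)b)+R_\alpha(aS_\beta(b))$ and $S_\alpha(a)S_\beta(b)=S_\beta(R_\alpha(a)b)+S_\alpha(aS_\beta(b))$. **Bracketed words.** For a set $X$ and nonempty set $\Lambda$, let $M(Y)$ be the free monoid on $Y$ and, for $\omega\in\Lambda$, let $\lfloor Y\rfloor_\omega=\{\lfloor y\rfloor_\omega\mid y\in Y\}$ be a disjoint copy of $Y$ (disjoint for different $\omega$). Set $\mathfrak{M}_0=M(X)$, $\mathfrak{M}_n=M(X\sqcup\bigsqcup_{\omega\in\Lambda}\lfloor\mathfrak{M}_{n-1}\rfloor_\omega)$, with the natural inclusions $\mathfrak{M}_{n-1}\hookrightarrow\mathfrak{M}_n$, and $\mathfrak{M}(\Lambda,X)=\bigcup_n\mathfrak{M}_n$, a monoid with identity $1$. $\mathbf{k}\mathfrak{M}(\Lambda,X)$ is the free module on it, with multiplication extended linearly and linear operators $w\mapsto\lfloor w\rfloor_\omega$; it is the free algebra on $X$ equipped with a family of linear operators indexed by $\Lambda$. Elements of $X\sqcup\bigsqcup_\omega\lfloor\mathfrak{M}(\Lambda,X)\rfloor_\omega$ are called prime; if $u=u_1\cdots u_n$ with $u_i$ prime, the breadth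 is $|u|=n$ (and $|1|=0$). $\mathfrak{M}^\star(\Lambda,X)$ is the set of words in $\mathfrak{M}(\Lambda,X\sqcup\{\star\})$ in which $\star$ occurs exactly once; $q|_u$ is obtained from $q$ by replacing $\star$ by $u$, extended linearly in $u$. $\mathrm{Id}(\mathbb{S})$ is the two-sided ideal, closed under all operators $\lfloor\,\rfloor_\omega$, generated by $\mathbb{S}$. Here $\Omega_R,\Omega_S$ are two disjoint copies of $\Omega$, $\Lambda=\Omega_R\sqcup\Omega_S$, and $\lfloor\,\rfloor^R_\omega$, $\lfloor\,\rfloor^S_\omega$ ($\omega\in\Omega$) denote the operators indexed by the copies of $\omega$ in $\Omega_R$, $\Omega_S$. In the quotient, the operators $R_\omega,S_\omega$ are those induced by $\lfloor\,\rfloor_\omega^R,\lfloor\,\rfloor_\omega^S$. **The order $\leq_{\mathrm{db}}$.** Fix well orders $\leq_X$ on $X$ and $\leq_\Omega$ on the set of operators $\{\lfloor\,\rfloor^R_\omega,\lfloor\,\rfloor^S_\omega\mid\omega\in\Omega\}$. Let $\deg(u)$ be the total number of occurrences in $u$ of letters of $X$ and of operators, counted with multiplicity. For $u=u_1\cdots u_m$, $v=v_1\cdots v_n$ with prime factors $u_i,v_j$, $u\leq_{\mathrm{db}}v$ is defined recursively by lexicographic comparison of $(\deg(u),|u|,u_1,\dots,u_m)$ and $(\deg(v),|v|,v_1,\dots,v_n)$, i.e. first by degree, then by breadth, then by prime factors lexicographically; two prime elements of equal degree are compared as follows: elements of $X$ by $\leq_X$; an element of $X$ is smaller than any bracket $\lfloor\tilde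 v\rfloor$; two brackets $\lfloor\tilde u\rfloor^{\ast_1}_\alpha,\lfloor\tilde v\rfloor^{\ast_2}_\beta$ by lexicographic comparison of $(\lfloor\,\rfloor^{\ast_1}_\alpha,\tilde u)$ and $(\lfloor\,\rfloor^{\ast_2}_\beta,\tilde v)$, using $\leq_\Omega$ and then $\leq_{\mathrm{db}}$. **Gröbner-Shirshov basis.** A monomial order is a well order $\leq$ on $\mathfrak{M}(\Lambda,X)$ such that $u<v$ implies $q|_u<q|_v$ for all $q\in\mathfrak{M}^\star(\Lambda,X)$. Given one, $\overline{f}$ denotes the leading monomial of $f\neq0$; $f$ is monic if its leading coefficient is $1$. Let $f,g$ be distinct monic elements. If $w=\overline{f}u=v\overline{g}$ for words $u,v,w$ with $\max\{|\overline f|,|\overline g|\}<|w|<|\overline f|+|\overline g|$, then $fu-vg$ is an intersection composition of $f,g$ with ambiguity $w$. If $w=\overline f=q|_{\overline g}$ with $q\in\mathfrak{M}^\star(\Lambda,X)$, then $f-q|_g$ is an including composition with ambiguity $w$. For a set $\mathbb{S}$ of monic elements, a composition $h$ with ambiguity $w$ is trivial modulo $(\mathbb{S},w)$ if $h=\sum_ic_iq_i|_{s_i}$ (finite sum) with $c_i\in\mathbf{k}\setminus\{0\}$, $q_i\in\mathfrak{M}^\star(\Lambda,X)$, $s_i\in\mathbb{S}$, $q_i|_{\overline{s_i}}<w$. $\mathbb{S}$ is a Gröbner-Shirshov basis if all intersection and including compositions of all pairs $f,g\in\mathbb{S}$ are trivial modulo $(\mathbb{S},w)$. *)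

theory Defs
  imports
    "HOL-Library.Poly_Mapping"
    "HOL-Algebra.Module"
    "HOL-Algebra.QuotRing"
    "HOL-Algebra.Algebraic_Closure_Type"
begin

section \<open>Matching Rota-Baxter systems\<close>

text \<open>
  The base ring is a type of class \<open>comm_ring_1\<close>, which is turned into a ring record by
  \<^const>\<open>ring_of_type_algebra\<close>.  Algebras have explicit carriers and may be zero.  (The locale
  \<open>algebra\<close> of the library covers commutative algebras only.)
\<close>

locale assoc_algebra =
  module ring_of_type_algebra A + ring A
  for A :: "('k::comm_ring_1, 'a) module" (structure) +
  assumes smult_mult_left:
      "\<lbrakk>a \<in> carrier A; b \<in> carrier A\<rbrakk> \<Longrightarrow>
        (c \<odot>\<^bsub>A\<^esub> a) \<otimes>\<^bsub>A\<^esub> b = c \<odot>\<^bsub>A\<^esub> (a \<otimes>\<^bsub>A\<^esub> b)"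
    and smult_mult_right:
      "\<lbrakk>a \<in> carrier A; b \<in> carrier A\<rbrakk> \<Longrightarrow>
        a \<otimes>\<^bsub>A\<^esub> (c \<odot>\<^bsub>A\<^esub> b) = c \<odot>\<^bsub>A\<^esub> (a \<otimes>\<^bsub>A\<^esub> b)"

definition linear_operators :: "('k, 'a) module \<Rightarrow> ('a \<Rightarrow> 'a) set" where
  "linear_operators A = {T \<in> carrier A \<rightarrow> carrier A.
     (\<forall>a\<in>carrier A. \<forall>b\<in>carrier A. T (a \<oplus>\<^bsub>A\<^esub> b) = T a \<oplus>\<^bsub>A\<^esub> T b) \<and>
     (\<forall>c. \<forall>a\<in>carrier A. T (c \<odot>\<^bsub>A\<^esub> a) = c \<odot>\<^bsub>A\<^esub> T a)}"

text \<open>The index set \<open>\<Omega>\<close> is the type \<open>'o\<close>, which is nonempty.\<close>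

locale matching_RB_system = assoc_algebra A
  for A :: "('k::comm_ring_1, 'a) module" (structure) +
  fixes R S :: "'o \<Rightarrow> 'a \<Rightarrow> 'a"
  assumes R_linear: "R \<alpha> \<in> linear_operators A"
    and S_linear: "S \<alpha> \<in> linear_operators A"
    and R_mult: "\<lbrakk>a \<in> carrier A; b \<in> carrier A\<rbrakk> \<Longrightarrow>
      R \<alpha> a \<otimes>\<^bsub>A\<^esub> R \<beta> b =
        R \<beta> (R \<alpha> a \<otimes>\<^bsub>A\<^esub> b) \<oplus>\<^bsub>A\<^esub> R \<alpha> (a \<otimes>\<^bsub>A\<^esub> S \<beta> b)"
    and S_mult: "\<lbrakk>a \<in> carrier A; b \<in> carrier A\<rbrakk> \<Longrightarrow>
      S \<alpha> a \<otimes>\<^bsub>A\<^esub> S \<beta> b =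
        S \<beta> (R \<alpha> a \<otimes>\<^bsub>A\<^esub> b) \<oplus>\<^bsub>A\<^esub> S \<alpha> (a \<otimes>\<^bsub>A\<^esub> S \<beta> b)"

definition matching_RB_hom ::
  "('k, 'a) module \<Rightarrow> ('o \<Rightarrow> 'a \<Rightarrow> 'a) \<Rightarrow> ('o \<Rightarrow> 'a \<Rightarrow> 'a) \<Rightarrow>
   ('k, 'b) module \<Rightarrow> ('o \<Rightarrow> 'b \<Rightarrow> 'b) \<Rightarrow> ('o \<Rightarrow> 'b \<Rightarrow> 'b) \<Rightarrow> ('a \<Rightarrow> 'b) set" where
  "matching_RB_hom A R S B R' S' = {h \<in> ring_hom A B.
     (\<forall>c. \<forall>a\<in>carrier A. h (c \<odot>\<^bsub>A\<^esub> a) = c \<odot>\<^bsub>B\<^esub> h a) \<and>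
     (\<forall>\<omega>. \<forall>a\<in>carrier A. h (R \<omega> a) = R' \<omega> (h a)) \<and>
     (\<forall>\<omega>. \<forall>a\<in>carrier A. h (S \<omega> a) = S' \<omega> (h a))}"

text \<open>
  Freeness on \<open>\<X>\<close> with respect to \<open>\<iota>\<close>, tested on all systems whose carrier is a subset of the
  type \<open>'b\<close>; a theorem about it in which \<open>'b\<close> is a type variable covers all systems.
  Homomorphisms only matter on the carrier, hence \<^const>\<open>extensional\<close>.
\<close>

definition free_matching_RB_system ::
  "'b itself \<Rightarrow> 'x set \<Rightarrow> ('x \<Rightarrow> 'a) \<Rightarrow>
   ('k::comm_ring_1, 'a) module \<Rightarrow> ('o \<Rightarrow> 'a \<Rightarrow> 'a) \<Rightarrow> ('o \<Rightarrow> 'a \<Rightarrow> 'a) \<Rightarrow> bool" where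
  "free_matching_RB_system _ \<X> \<iota> A R S \<longleftrightarrow>
     matching_RB_system A R S \<and> \<iota> \<in> \<X> \<rightarrow> carrier A \<and>
     (\<forall>(B :: ('k, 'b) module) R' S' f.
        matching_RB_system B R' S' \<and> f \<in> \<X> \<rightarrow> carrier B \<longrightarrow>
        (\<exists>!h. h \<in> extensional (carrier A) \<and> h \<in> matching_RB_hom A R S B R' S' \<and>
              (\<forall>x\<in>\<X>. h (\<iota> x) = f x)))"

definition module_basis ::
  "('k::comm_ring_1, 'a) module \<Rightarrow> 'w set \<Rightarrow> ('w \<Rightarrow> 'a) \<Rightarrow> bool" where
  "module_basis A W b \<longleftrightarrow>
     b \<in> W \<rightarrow> carrier A \<and>
     (\<forall>a\<in>carrier A. \<exists>F c. finite F \<and> F \<subseteq> W \<and> a = (\<Oplus>\<^bsub>A\<^esub>w\<in>F. c w \<odot>\<^bsub>A\<^esub> b w)) \<and>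
     (\<forall>F c. finite F \<and> F \<subseteq> W \<and> (\<Oplus>\<^bsub>A\<^esub>w\<in>F. c w \<odot>\<^bsub>A\<^esub> b w) = \<zero>\<^bsub>A\<^esub> \<longrightarrow>
            (\<forall>w\<in>F. c w = 0))"


section \<open>Bracketed words\<close>

text \<open>
  \<open>'l\<close> is the type of operator labels.  A word is the list of its prime factors, so the breadth
  is \<^const>\<open>length\<close>, the product is \<open>@\<close>, the identity is \<open>[]\<close>, and the inclusions between the
  stages are inclusions of sets.
\<close>

datatype ('l, 'x) bprime = Letter 'x | Bracket 'l "('l, 'x) bprime list"

type_synonym ('l, 'x) bword = "('l, 'x) bprime list"

primrec bstage :: "'x set \<Rightarrow> nat \<Rightarrow> ('l, 'x) bword set" where
  "bstage \<X> 0 = lists (Letter ` \<X>)"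
| "bstage \<X> (Suc n) = lists (Letter ` \<X> \<union> (\<Union>l. Bracket l ` bstage \<X> n))"

definition bwords :: "'x set \<Rightarrow> ('l, 'x) bword set" where
  "bwords \<X> = (\<Union>n. bstage \<X> n)"

primrec pdeg :: "('l, 'x) bprime \<Rightarrow> nat" where
  "pdeg (Letter x) = 1"
| "pdeg (Bracket l u) = Suc (sum_list (map pdeg u))"

definition wdeg :: "('l, 'x) bword \<Rightarrow> nat" where
  "wdeg u = sum_list (map pdeg u)"

text \<open>The letter \<open>\<star>\<close> is \<^const>\<open>None\<close>, so \<open>\<X> \<squnion> {\<star>}\<close> is \<open>insert None (Some ` \<X>)\<close>.\<close>

primrec pstars :: "('l, 'x option) bprime \<Rightarrow> nat" where
  "pstars (Letter y) = (case y of None \<Rightarrow> 1 | Some x \<Rightarrow> 0)"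
| "pstars (Bracket l u) = sum_list (map pstars u)"

definition star_words :: "'x set \<Rightarrow> ('l, 'x option) bword set" where
  "star_words \<X> = {q \<in> bwords (insert None (Some ` \<X>)). sum_list (map pstars q) = 1}"

primrec psubst :: "('l, 'x) bword \<Rightarrow> ('l, 'x option) bprime \<Rightarrow> ('l, 'x) bword" where
  "psubst u (Letter y) = (case y of None \<Rightarrow> u | Some x \<Rightarrow> [Letter x])"
| "psubst u (Bracket l q) = [Bracket l (concat (map (psubst u) q))]"

definition subst :: "('l, 'x option) bword \<Rightarrow> ('l, 'x) bword \<Rightarrow> ('l, 'x) bword" where
  "subst q u = concat (map (psubst u) q)"


section \<open>The free operated algebra\<close>

text \<open>
  With concatenation as the addition required by the convolution product of
  \<^theory>\<open>HOL-Library.Poly_Mapping\<close>, the type \<open>('l, 'x) bword \<Rightarrow>\<^sub>0 'k\<close> is the monoid algebra of the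
  words.
\<close>

instantiation list :: (type) monoid_add
begin

definition zero_list :: "'a list" where "zero_list = []"
definition plus_list :: "'a list \<Rightarrow> 'a list \<Rightarrow> 'a list" where "plus_list = append"

instance by standard (simp_all add: zero_list_def plus_list_def)

end

definition mon :: "('l, 'x) bword \<Rightarrow> ('l, 'x) bword \<Rightarrow>\<^sub>0 'k::comm_ring_1" where
  "mon u = Poly_Mapping.single u 1"

definition scale :: "'k::comm_ring_1 \<Rightarrow> (('l, 'x) bword \<Rightarrow>\<^sub>0 'k) \<Rightarrow> ('l, 'x) bword \<Rightarrow>\<^sub>0 'k" where
  "scale c f = Poly_Mapping.map ((*) c) f"

definition lin_ext ::
  "(('l, 'y) bword \<Rightarrow> ('l, 'x) bword) \<Rightarrow> (('l, 'y) bword \<Rightarrow>\<^sub>0 'k) \<Rightarrow> ('l, 'x) bword \<Rightarrow>\<^sub>0 'k::comm_ring_1"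
  where "lin_ext \<phi> f = (\<Sum>u\<in>Poly_Mapping.keys f. scale (Poly_Mapping.lookup f u) (mon (\<phi> u)))"

definition bracket :: "'l \<Rightarrow> (('l, 'x) bword \<Rightarrow>\<^sub>0 'k) \<Rightarrow> ('l, 'x) bword \<Rightarrow>\<^sub>0 'k::comm_ring_1" where
  "bracket l = lin_ext (\<lambda>u. [Bracket l u])"

definition plug ::
  "('l, 'x option) bword \<Rightarrow> (('l, 'x) bword \<Rightarrow>\<^sub>0 'k) \<Rightarrow> ('l, 'x) bword \<Rightarrow>\<^sub>0 'k::comm_ring_1" where
  "plug q = lin_ext (subst q)"

definition free_operated_algebra ::
  "'x set \<Rightarrow> ('k::comm_ring_1, ('l, 'x) bword \<Rightarrow>\<^sub>0 'k) module" where
  "free_operated_algebra \<X> =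
     \<lparr>carrier = {f. Poly_Mapping.keys f \<subseteq> bwords \<X>}, monoid.mult = (*), one = 1, zero = 0, add = (+),
      module.smult = scale\<rparr>"

definition operated_ideal ::
  "'x set \<Rightarrow> (('l, 'x) bword \<Rightarrow>\<^sub>0 'k::comm_ring_1) set \<Rightarrow> (('l, 'x) bword \<Rightarrow>\<^sub>0 'k) set" where
  "operated_ideal \<X> S = \<Inter>{I. ideal I (free_operated_algebra \<X>) \<and>
     (\<forall>l. \<forall>f\<in>I. bracket l f \<in> I) \<and> S \<subseteq> I}"

text \<open>
  The map on cosets induced by an additive \<open>T\<close> with \<open>T ` I \<subseteq> I\<close>: it sends \<open>I + a\<close> to \<open>I + T a\<close>.
\<close>

definition induced_map :: "('k, 'a) module \<Rightarrow> 'a set \<Rightarrow> ('a \<Rightarrow> 'a) \<Rightarrow> 'a set \<Rightarrow> 'a set" where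
  "induced_map A I T C = I <+>\<^bsub>A\<^esub> T ` C"

definition quotient_algebra :: "('k, 'a) module \<Rightarrow> 'a set \<Rightarrow> ('k, 'a set) module" where
  "quotient_algebra A I =
     ring.extend (A Quot I) (module.fields (\<lambda>c. induced_map A I (\<lambda>a. c \<odot>\<^bsub>A\<^esub> a)))"


section \<open>Groebner-Shirshov bases\<close>

text \<open>Orders are reflexive relations \<open>r\<close>, where \<open>(u, v) \<in> r\<close> means \<open>u \<le> v\<close>.\<close>

definition strictly :: "'a rel \<Rightarrow> 'a \<Rightarrow> 'a \<Rightarrow> bool" where
  "strictly r u v \<longleftrightarrow> (u, v) \<in> r \<and> u \<noteq> v"

definition monomial_order :: "'x set \<Rightarrow> ('l, 'x) bword rel \<Rightarrow> bool" where
  "monomial_order \<X> r \<longleftrightarrow> well_order_on (bwords \<X>) r \<and>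
     (\<forall>q\<in>star_words \<X>. \<forall>u v. strictly r u v \<longrightarrow> strictly r (subst q u) (subst q v))"

definition lead :: "('l, 'x) bword rel \<Rightarrow> (('l, 'x) bword \<Rightarrow>\<^sub>0 'k::comm_ring_1) \<Rightarrow> ('l, 'x) bword" where
  "lead r f = (THE w. w \<in> Poly_Mapping.keys f \<and> (\<forall>v\<in>Poly_Mapping.keys f. (v, w) \<in> r))"

definition monic :: "('l, 'x) bword rel \<Rightarrow> (('l, 'x) bword \<Rightarrow>\<^sub>0 'k::comm_ring_1) \<Rightarrow> bool" where
  "monic r f \<longleftrightarrow> f \<noteq> 0 \<and> Poly_Mapping.lookup f (lead r f) = 1"

definition intersection_composition ::
  "'x set \<Rightarrow> ('l, 'x) bword rel \<Rightarrow> (('l, 'x) bword \<Rightarrow>\<^sub>0 'k) \<Rightarrow> (('l, 'x) bword \<Rightarrow>\<^sub>0 'k) \<Rightarrow>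
   ('l, 'x) bword \<Rightarrow> (('l, 'x) bword \<Rightarrow>\<^sub>0 'k::comm_ring_1) \<Rightarrow> bool" where
  "intersection_composition \<X> r f g w h \<longleftrightarrow>
     (\<exists>u\<in>bwords \<X>. \<exists>v\<in>bwords \<X>.
        w = lead r f @ u \<and> w = v @ lead r g \<and>
        max (length (lead r f)) (length (lead r g)) < length w \<and>
        length w < length (lead r f) + length (lead r g) \<and>
        h = f * mon u - mon v * g)"

definition including_composition ::
  "'x set \<Rightarrow> ('l, 'x) bword rel \<Rightarrow> (('l, 'x) bword \<Rightarrow>\<^sub>0 'k) \<Rightarrow> (('l, 'x) bword \<Rightarrow>\<^sub>0 'k) \<Rightarrow>
   ('l, 'x) bword \<Rightarrow> (('l, 'x) bword \<Rightarrow>\<^sub>0 'k::comm_ring_1) \<Rightarrow> bool" where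
  "including_composition \<X> r f g w h \<longleftrightarrow>
     (\<exists>q\<in>star_words \<X>. w = lead r f \<and> w = subst q (lead r g) \<and> h = f - plug q g)"

definition trivial_modulo ::
  "'x set \<Rightarrow> ('l, 'x) bword rel \<Rightarrow> (('l, 'x) bword \<Rightarrow>\<^sub>0 'k) set \<Rightarrow>
   ('l, 'x) bword \<Rightarrow> (('l, 'x) bword \<Rightarrow>\<^sub>0 'k::comm_ring_1) \<Rightarrow> bool" where
  "trivial_modulo \<X> r S w h \<longleftrightarrow>
     (\<exists>(n::nat) c q s.
        (\<forall>i<n. c i \<noteq> 0 \<and> q i \<in> star_words \<X> \<and> s i \<in> S \<and> strictly r (subst (q i) (lead r (s i))) w) \<and>
        h = (\<Sum>i<n. scale (c i) (plug (q i) (s i))))"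

definition groebner_shirshov_basis ::
  "'x set \<Rightarrow> ('l, 'x) bword rel \<Rightarrow> (('l, 'x) bword \<Rightarrow>\<^sub>0 'k::comm_ring_1) set \<Rightarrow> bool" where
  "groebner_shirshov_basis \<X> r S \<longleftrightarrow>
     S \<subseteq> carrier (free_operated_algebra \<X>) \<and> (\<forall>f\<in>S. monic r f) \<and>
     (\<forall>f\<in>S. \<forall>g\<in>S. \<forall>w h.
        f \<noteq> g \<and> (intersection_composition \<X> r f g w h \<or> including_composition \<X> r f g w h) \<longrightarrow>
        trivial_modulo \<X> r S w h)"

definition irreducibles ::
  "'x set \<Rightarrow> ('l, 'x) bword rel \<Rightarrow> (('l, 'x) bword \<Rightarrow>\<^sub>0 'k::comm_ring_1) set \<Rightarrow> ('l, 'x) bword set" where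
  "irreducibles \<X> r S = {w \<in> bwords \<X>. \<forall>q\<in>star_words \<X>. \<forall>s\<in>S. w \<noteq> subst q (lead r s)}"


section \<open>The order \<open>\<le>\<^sub>d\<^sub>b\<close>\<close>

text \<open>
  The strict order on words and its restriction to primes.  For words of equal degree and breadth,
  \<open>p\<close> and \<open>p'\<close> in the third rule are the first prime factors that differ.
\<close>

inductive db_less :: "'x rel \<Rightarrow> 'l rel \<Rightarrow> ('l, 'x) bword \<Rightarrow> ('l, 'x) bword \<Rightarrow> bool"
  and db_less_prime :: "'x rel \<Rightarrow> 'l rel \<Rightarrow> ('l, 'x) bprime \<Rightarrow> ('l, 'x) bprime \<Rightarrow> bool"
  for rX :: "'x rel" and rL :: "'l rel" where
  less_deg: "wdeg u < wdeg v \<Longrightarrow> db_less rX rL u v"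
| less_breadth: "wdeg u = wdeg v \<Longrightarrow> length u < length v \<Longrightarrow> db_less rX rL u v"
| less_factor: "wdeg (t @ p # u) = wdeg (t @ p' # v) \<Longrightarrow> length u = length v \<Longrightarrow>
    db_less_prime rX rL p p' \<Longrightarrow> db_less rX rL (t @ p # u) (t @ p' # v)"
| prime_deg: "pdeg p < pdeg p' \<Longrightarrow> db_less_prime rX rL p p'"
| letter_letter: "strictly rX x y \<Longrightarrow> db_less_prime rX rL (Letter x) (Letter y)"
| letter_bracket: "pdeg (Letter x :: ('l, 'x) bprime) = pdeg (Bracket b v) \<Longrightarrow>
    db_less_prime rX rL (Letter x) (Bracket b v)"
| bracket_label: "pdeg (Bracket a u) = pdeg (Bracket b v) \<Longrightarrow> strictly rL a b \<Longrightarrow>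
    db_less_prime rX rL (Bracket a u) (Bracket b v)"
| bracket_arg: "pdeg (Bracket a u) = pdeg (Bracket a v) \<Longrightarrow> db_less rX rL u v \<Longrightarrow>
    db_less_prime rX rL (Bracket a u) (Bracket a v)"

definition db_order :: "'x set \<Rightarrow> 'x rel \<Rightarrow> 'l rel \<Rightarrow> ('l, 'x) bword rel" where
  "db_order \<X> rX rL = {(u, v). u \<in> bwords \<X> \<and> v \<in> bwords \<X> \<and> (u = v \<or> db_less rX rL u v)}"


section \<open>The matching Rota-Baxter relations\<close>

text \<open>
  The set of labels \<open>\<Omega>\<^sub>R \<squnion> \<Omega>\<^sub>S\<close> is the type \<open>'o + 'o\<close>, with \<^const>\<open>Inl\<close> for \<open>\<Omega>\<^sub>R\<close> and \<^const>\<open>Inr\<close> for \<open>\<Omega>\<^sub>S\<close>.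
\<close>

abbreviation brR :: "'o \<Rightarrow> ('o + 'o, 'x) bword \<Rightarrow> ('o + 'o, 'x) bword" where
  "brR \<omega> u \<equiv> [Bracket (Inl \<omega>) u]"

abbreviation brS :: "'o \<Rightarrow> ('o + 'o, 'x) bword \<Rightarrow> ('o + 'o, 'x) bword" where
  "brS \<omega> u \<equiv> [Bracket (Inr \<omega>) u]"

definition S_MS :: "'x set \<Rightarrow> (('o + 'o, 'x) bword \<Rightarrow>\<^sub>0 'k::comm_ring_1) set" where
  "S_MS \<X> =
     {mon (brR \<alpha> u @ brR \<beta> v) - mon (brR \<beta> (brR \<alpha> u @ v)) - mon (brR \<alpha> (u @ brS \<beta> v))
       | u v \<alpha> \<beta>. u \<in> bwords \<X> \<and> v \<in> bwords \<X>} \<union>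
     {mon (brS \<alpha> u @ brS \<beta> v) - mon (brS \<beta> (brR \<alpha> u @ v)) - mon (brS \<alpha> (u @ brS \<beta> v))
       | u v \<alpha> \<beta>. u \<in> bwords \<X> \<and> v \<in> bwords \<X>}"

definition quotient_MS ::
  "'x set \<Rightarrow> ('k::comm_ring_1, (('o + 'o, 'x) bword \<Rightarrow>\<^sub>0 'k) set) module" where
  "quotient_MS \<X> = quotient_algebra (free_operated_algebra \<X>) (operated_ideal \<X> (S_MS \<X>))"

definition quotient_op ::
  "'x set \<Rightarrow> 'o + 'o \<Rightarrow> (('o + 'o, 'x) bword \<Rightarrow>\<^sub>0 'k::comm_ring_1) set \<Rightarrow>
   (('o + 'o, 'x) bword \<Rightarrow>\<^sub>0 'k) set" where
  "quotient_op \<X> l = induced_map (free_operated_algebra \<X>) (operated_ideal \<X> (S_MS \<X>)) (bracket l)"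

definition word_class ::
  "'x set \<Rightarrow> ('o + 'o, 'x) bword \<Rightarrow> (('o + 'o, 'x) bword \<Rightarrow>\<^sub>0 'k::comm_ring_1) set" where
  "word_class \<X> w = operated_ideal \<X> (S_MS \<X>) +>\<^bsub>free_operated_algebra \<X>\<^esub> mon w"

end

(*
  Since only adjacent brackets of the same side interact, every composition can be resolved explicitly,
  which gives (a).  For (b), spanning is well-founded reduction along the order.  Linear independence does
  not go through the Composition-Diamond Lemma.  Instead, the span of all words is given a second product,
  which resolves the interaction between the last prime factor of the left word and the first prime factor
  of the right word by the defining relations.  It is associative on all words, not only on the
  irreducible ones, and the bracket operators make it a matching Rota-Baxter system.  Evaluating the free
  operated algebra in this system kills the ideal and fixes every irreducible word.
*)

theory Submission
  imports Defs
begin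

section \<open>Bracketed words\<close>

text \<open>Both families of relations have one shape: the two outer labels are those of the
  multiplied brackets, while the inner label is on the R side in the first subtracted word and on
  the S side in the second. With \<open>to_R\<close> and \<open>to_S\<close> for these changes of
  side, the only hypothesis left is \<open>isl l = isl m\<close>, and every argument runs once. Each
  relation is homogeneous for the degree and trades a word of breadth two for words of breadth one,
  so inside a relation breadth alone decides the order. Leaving reducible pairs inside a word
  untouched spares the new product any closure argument about irreducible words and makes it local:
  only the two factors that meet matter. The one real case of associativity is that of three
  brackets on the same side. There both bracketings expand to four terms, two of which recombine by
  a relation whose sides have been changed, and the same three terms remain. This cancellation is
  also the one that resolves the intersection compositions.\<close>

definition bprimes :: "'x set \<Rightarrow> ('l, 'x) bprime set" where
  "bprimes \<X> = {p. set2_bprime p \<subseteq> \<X>}"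

lemma wdeg_simps [simp]:
  "wdeg [] = 0" "wdeg (p # u) = pdeg p + wdeg u" "wdeg (u @ v) = wdeg u + wdeg v"
  by (simp_all add: wdeg_def)

lemma pdeg_Bracket [simp]: "pdeg (Bracket l u) = Suc (wdeg u)"
  by (simp add: wdeg_def)

declare pdeg.simps(2) [simp del]

lemma pdeg_pos [simp]: "0 < pdeg p"
  by (cases p) auto

lemma wdeg_eq_0 [simp]: "wdeg u = 0 \<longleftrightarrow> u = []"
  by (cases u) auto

lemma pdeg_le_wdeg: "p \<in> set u \<Longrightarrow> pdeg p \<le> wdeg u"
  by (induction u) auto

lemma bstage_subset: "bstage \<X> n \<subseteq> lists (bprimes \<X>)"
  by (induction n) (fastforce simp: bprimes_def)+

text \<open>The degree bounds the nesting depth, so a word of degree at most \<open>n\<close> with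
  letters in \<X> already occurs at stage \<open>n\<close>. From here on the stages are replaced by
  a condition on the letters at all depths, as collected by \<open>set2_bprime\<close>.\<close>

lemma bwords_eq:
  fixes \<X> :: "'x set"
  shows "bwords \<X> = lists (bprimes \<X>)"
proof
  show "bwords \<X> \<subseteq> lists (bprimes \<X>)"
    using bstage_subset unfolding bwords_def by blast
  have "u \<in> bstage \<X> n" if "u \<in> lists (bprimes \<X>)" "wdeg u \<le> n" for u :: "('l, 'x) bword" and n
    using that
  proof (induction n arbitrary: u)
    case (Suc n)
    have "p \<in> Letter ` \<X> \<union> (\<Union>l. Bracket l ` bstage \<X> n)" if p: "p \<in> set u" for p
    proof (cases p)
      case (Letter x)
      with p Suc.prems(1) show ?thesis by (fastforce simp: bprimes_def)
    next
      case (Bracket l a)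
      have "wdeg a \<le> n" using pdeg_le_wdeg[OF p] Suc.prems(2) Bracket by simp
      moreover have "a \<in> lists (bprimes \<X>)"
        using p Suc.prems(1) Bracket by (fastforce simp: bprimes_def)
      ultimately show ?thesis using Suc.IH Bracket by blast
    qed
    then show ?case by auto
  qed simp
  then show "lists (bprimes \<X>) \<subseteq> bwords \<X>"
    unfolding bwords_def by blast
qed

lemma bwords_simps [simp]:
  "[] \<in> bwords \<X>"
  "p # u \<in> bwords \<X> \<longleftrightarrow> p \<in> bprimes \<X> \<and> u \<in> bwords \<X>"
  "u @ v \<in> bwords \<X> \<longleftrightarrow> u \<in> bwords \<X> \<and> v \<in> bwords \<X>"
  "Letter x \<in> bprimes \<X> \<longleftrightarrow> x \<in> \<X>"
  "Bracket l u \<in> bprimes \<X> \<longleftrightarrow> u \<in> bwords \<X>"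
  by (auto simp: bwords_eq bprimes_def)

lemma bwords_UNIV [simp]: "bwords UNIV = UNIV" "bprimes UNIV = UNIV"
  by (auto simp: bwords_eq bprimes_def)

text \<open>The contents of a leading bracket and the remaining factors both have smaller degree, so
  one induction on \<open>wdeg\<close> serves for the mutual recursion of primes and words.\<close>

lemma bword_induct [consumes 1, case_names Nil Letter Bracket]:
  assumes "u \<in> bwords \<X>"
    and "P []"
    and "\<And>x u. x \<in> \<X> \<Longrightarrow> u \<in> bwords \<X> \<Longrightarrow> P u \<Longrightarrow> P (Letter x # u)"
    and "\<And>l a u. a \<in> bwords \<X> \<Longrightarrow> u \<in> bwords \<X> \<Longrightarrow> P a \<Longrightarrow> P u \<Longrightarrow> P (Bracket l a # u)"
  shows "P u"
  using assms(1)
proof (induction "wdeg u" arbitrary: u rule: less_induct)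
  case less
  show ?case
  proof (cases u)
    case (Cons p v)
    then show ?thesis
      using less assms(3,4) by (cases p) auto
  qed (simp add: assms(2))
qed

section \<open>Words with one star, read as contexts\<close>

definition lift_word :: "('l, 'x) bword \<Rightarrow> ('l, 'x option) bword" where
  "lift_word = map (map_bprime id Some)"

lemma lift_word_simps [simp]:
  "lift_word [] = []"
  "lift_word (Letter x # u) = Letter (Some x) # lift_word u"
  "lift_word (Bracket l a # u) = Bracket l (lift_word a) # lift_word u"
  by (simp_all add: lift_word_def)

definition stars :: "('l, 'x option) bword \<Rightarrow> nat" where
  "stars q = sum_list (map pstars q)"

lemma stars_simps [simp]:
  "stars [] = 0" "stars (Letter None # q) = Suc (stars q)" "stars (Letter (Some x) # q) = stars q"
  "stars (Bracket l a # q) = stars a + stars q" "stars (q @ q') = stars q + stars q'"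
  by (simp_all add: stars_def)

lemma subst_simps [simp]:
  "subst [] u = []" "subst (Letter None # q) u = u @ subst q u"
  "subst (Letter (Some x) # q) u = Letter x # subst q u"
  "subst (Bracket l a # q) u = Bracket l (subst a u) # subst q u"
  "subst (q @ q') u = subst q u @ subst q' u"
  by (simp_all add: subst_def)

lemma lift_word_props:
  fixes a :: "('l, 'x) bword"
  shows "stars (lift_word a) = 0" "subst (lift_word a) u = a"
    "a \<in> bwords \<X> \<Longrightarrow> lift_word a \<in> bwords (insert None (Some ` \<X>))"
proof -
  have "a \<in> bwords UNIV" by simp
  then show "stars (lift_word a) = 0" "subst (lift_word a) u = a"
    by (induction a rule: bword_induct) auto
  show "a \<in> bwords \<X> \<Longrightarrow> lift_word a \<in> bwords (insert None (Some ` \<X>))"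
    by (induction a rule: bword_induct) auto
qed

lemmas subst_lift_word [simp] = lift_word_props(2)

lemma star_free_lift:
  assumes "q \<in> bwords (insert None (Some ` \<X>))" "stars q = 0"
  shows "\<exists>a\<in>bwords \<X>. q = lift_word a"
  using assms
proof (induction q rule: bword_induct)
  case Nil
  then show ?case by (auto intro!: bexI[of _ "[]"])
next
  case (Letter x q)
  then obtain y a where "x = Some y" "y \<in> \<X>" "a \<in> bwords \<X>" "q = lift_word a" by auto
  then show ?case by (auto intro!: bexI[of _ "Letter y # a"])
next
  case (Bracket l r q)
  then obtain a b where "a \<in> bwords \<X>" "r = lift_word a" "b \<in> bwords \<X>" "q = lift_word b" by auto
  then show ?case by (auto intro!: bexI[of _ "Bracket l a # b"])
qed

lemma star_words_iff: "q \<in> star_words \<X> \<longleftrightarrow> q \<in> bwords (insert None (Some ` \<X>)) \<and> stars q = 1"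
  by (simp add: star_words_def stars_def)

lemma star_words_intros [simp, intro]:
  "[Letter None] \<in> star_words \<X>"
  "q \<in> star_words \<X> \<Longrightarrow> [Bracket l q] \<in> star_words \<X>"
  "a \<in> bwords \<X> \<Longrightarrow> q \<in> star_words \<X> \<Longrightarrow> lift_word a @ q \<in> star_words \<X>"
  "b \<in> bwords \<X> \<Longrightarrow> q \<in> star_words \<X> \<Longrightarrow> q @ lift_word b \<in> star_words \<X>"
  by (auto simp: star_words_iff lift_word_props)

text \<open>As the star occurs once, all prime factors but one are images of plain words. The
  exceptional one is the star itself or a bracket around a smaller context, which gives the
  recursion behind every statement about contexts.\<close>

lemma star_words_cases [consumes 1, case_names star bracket]:
  assumes "q \<in> star_words \<X>"
  obtains (star) a b where "a \<in> bwords \<X>" "b \<in> bwords \<X>" "q = lift_word a @ [Letter None] @ lift_word b"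
  | (bracket) a l r b where "a \<in> bwords \<X>" "b \<in> bwords \<X>" "r \<in> star_words \<X>"
      "q = lift_word a @ [Bracket l r] @ lift_word b"
proof -
  have "(\<exists>a\<in>bwords \<X>. \<exists>b\<in>bwords \<X>. q = lift_word a @ [Letter None] @ lift_word b) \<or>
    (\<exists>a\<in>bwords \<X>. \<exists>b\<in>bwords \<X>. \<exists>r\<in>star_words \<X>. \<exists>l. q = lift_word a @ [Bracket l r] @ lift_word b)"
    if "q \<in> bwords (insert None (Some ` \<X>))" "stars q = 1"
    using that
  proof (induction q rule: bword_induct)
    case (Letter y q)
    show ?case
    proof (cases y)
      case None
      with Letter star_free_lift[of q \<X>] obtain b where "b \<in> bwords \<X>" "q = lift_word b" by auto
      with None show ?thesis
        by (intro disjI1 bexI[of _ "[]"] bexI[of _ b]) auto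
    next
      case (Some x)
      with Letter consider
          (1) a b where "a \<in> bwords \<X>" "b \<in> bwords \<X>" "q = lift_word a @ [Letter None] @ lift_word b"
        | (2) a l r b where "a \<in> bwords \<X>" "b \<in> bwords \<X>" "r \<in> star_words \<X>"
          "q = lift_word a @ [Bracket l r] @ lift_word b" by auto
      then show ?thesis
      proof cases
        case 1
        with Some Letter show ?thesis by (intro disjI1 bexI[of _ "Letter x # a"] bexI[of _ b]) auto
      next
        case 2
        with Some Letter show ?thesis by (intro disjI2 bexI[of _ "Letter x # a"] bexI[of _ b] bexI[of _ r]) auto
      qed
    qed
  next
    case (Bracket m c q)
    show ?case
    \<comment> \<open>Either the head bracket is free of the star, which then lies in the tail, or
      the star lies in this bracket and the tail is a plain word.\<close>
    proof (cases "stars c = 0")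
      case True
      then obtain c' where c': "c' \<in> bwords \<X>" "c = lift_word c'"
        using star_free_lift Bracket by blast
      from True Bracket consider
          (1) a b where "a \<in> bwords \<X>" "b \<in> bwords \<X>" "q = lift_word a @ [Letter None] @ lift_word b"
        | (2) a l r b where "a \<in> bwords \<X>" "b \<in> bwords \<X>" "r \<in> star_words \<X>"
          "q = lift_word a @ [Bracket l r] @ lift_word b" by auto
      then show ?thesis
      proof cases
        case 1
        with c' show ?thesis by (intro disjI1 bexI[of _ "Bracket m c' # a"] bexI[of _ b]) auto
      next
        case 2
        with c' show ?thesis by (intro disjI2 bexI[of _ "Bracket m c' # a"] bexI[of _ b] bexI[of _ r]) auto
      qed
    next
      case False
      with Bracket have c: "c \<in> star_words \<X>" and q: "stars q = 0" by (auto simp: star_words_iff)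
      from q Bracket star_free_lift obtain b where "b \<in> bwords \<X>" "q = lift_word b" by blast
      with c show ?thesis by (intro disjI2 bexI[of _ "[]"] bexI[of _ b] bexI[of _ c]) auto
    qed
  qed simp
  with assms have "(\<exists>a\<in>bwords \<X>. \<exists>b\<in>bwords \<X>. q = lift_word a @ [Letter None] @ lift_word b) \<or>
    (\<exists>a\<in>bwords \<X>. \<exists>b\<in>bwords \<X>. \<exists>r\<in>star_words \<X>. \<exists>l. q = lift_word a @ [Bracket l r] @ lift_word b)"
    by (simp add: star_words_iff[of q])
  with that show thesis by blast
qed

lemma star_words_induct [consumes 1, case_names star bracket]:
  assumes "q \<in> star_words \<X>"
    and "\<And>a b. a \<in> bwords \<X> \<Longrightarrow> b \<in> bwords \<X> \<Longrightarrow> P (lift_word a @ [Letter None] @ lift_word b)"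
    and "\<And>a l r b. a \<in> bwords \<X> \<Longrightarrow> b \<in> bwords \<X> \<Longrightarrow> r \<in> star_words \<X> \<Longrightarrow> P r \<Longrightarrow>
      P (lift_word a @ [Bracket l r] @ lift_word b)"
  shows "P q"
  using assms(1)
proof (induction "wdeg q" arbitrary: q rule: less_induct)
  case less
  from less.prems show ?case
  proof (cases rule: star_words_cases)
    case (star a b)
    then show ?thesis using assms(2) by blast
  next
    case (bracket a l r b)
    moreover from this have "P r" by (intro less.hyps) auto
    ultimately show ?thesis using assms(3) by blast
  qed
qed

lemma subst_in_bwords:
  "q \<in> star_words \<X> \<Longrightarrow> u \<in> bwords \<X> \<Longrightarrow> subst q u \<in> bwords \<X>"
  by (induction q rule: star_words_induct) auto

section \<open>Linear maps on the word algebra\<close>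

lemma scale_conv_mult: "scale c f = Poly_Mapping.single [] c * f"
  by (simp add: scale_def mult_map_scale_conv_mult flip: zero_list_def)

lemma lookup_scale [simp]: "Poly_Mapping.lookup (scale c f) u = c * Poly_Mapping.lookup f u"
  by (simp add: scale_def Poly_Mapping.map.rep_eq when_def)

lemma lookup_mon: "Poly_Mapping.lookup (mon u) v = (if u = v then 1 else 0)"
  by (simp add: mon_def lookup_single when_def)

lemma keys_mon [simp]: "Poly_Mapping.keys (mon u :: _ \<Rightarrow>\<^sub>0 'k::comm_ring_1) = {u}"
  by (simp add: mon_def)

lemma keys_scale: "Poly_Mapping.keys (scale c f) \<subseteq> Poly_Mapping.keys f"
  by (auto simp: in_keys_iff)

lemma scale_simps [simp]:
  "scale c 0 = 0" "scale 0 f = 0" "scale 1 f = f" "scale c (scale d f) = scale (c * d) f"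
  by (auto intro!: poly_mapping_eqI simp: mult.assoc)

lemma scale_distrib:
  "scale c (f + g) = scale c f + scale c g" "scale (c + d) f = scale c f + scale d f"
  "scale c (f - g) = scale c f - scale c g"
  by (auto intro!: poly_mapping_eqI simp: lookup_add lookup_minus algebra_simps)

lemma scale_minus_one: "scale (- 1) f = - f"
  by (auto intro!: poly_mapping_eqI)

lemma scale_sum: "scale c (sum f A) = (\<Sum>i\<in>A. scale c (f i))"
  by (induction A rule: infinite_finite_induct) (auto simp: scale_distrib)

lemma mon_mult [simp]: "mon u * mon v = mon (u @ v)"
  by (simp add: mon_def mult_single plus_list_def)

lemma mon_mult_left [simp]: "mon u * (mon v * f) = mon (u @ v) * f"
  by (simp flip: mult.assoc)

lemma mon_Nil: "mon [] = 1"
  by (simp add: mon_def flip: zero_list_def)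

lemma mon_Nil_mult [simp]: "mon [] * f = f" "f * mon [] = f"
  by (simp_all add: mon_Nil)

lemma word_algebra_expand:
  "(\<Sum>u\<in>Poly_Mapping.keys f. scale (Poly_Mapping.lookup f u) (mon u)) = f"
  by (intro poly_mapping_eqI)
    (auto simp: lookup_sum lookup_mon if_distrib[of "(*) _"] not_in_keys_iff_lookup_eq_zero sum.delta
      cong: if_cong)

lemma word_algebra_induct [consumes 1, case_names zero add mon]:
  assumes "Poly_Mapping.keys f \<subseteq> W" and "P 0" and "\<And>f g. Poly_Mapping.keys f \<subseteq> W \<Longrightarrow> Poly_Mapping.keys g \<subseteq> W \<Longrightarrow> P f \<Longrightarrow> P g \<Longrightarrow> P (f + g)"
    and "\<And>c u. u \<in> W \<Longrightarrow> P (scale c (mon u))"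
  shows "P f"
proof -
  have "Poly_Mapping.keys (\<Sum>u\<in>F. scale (Poly_Mapping.lookup f u) (mon u)) \<subseteq> W \<and>
    P (\<Sum>u\<in>F. scale (Poly_Mapping.lookup f u) (mon u))" if "finite F" "F \<subseteq> W" for F
    using that
  proof (induction F)
    case empty
    then show ?case by (simp add: assms(2))
  next
    case (insert u F)
    have "Poly_Mapping.keys (scale (Poly_Mapping.lookup f u) (mon u)) \<subseteq> W"
      using insert.prems keys_scale[of _ "mon u"] by auto
    with insert show ?case
      using keys_add[of "scale (Poly_Mapping.lookup f u) (mon u)"] by (simp add: assms(3,4)) blast
  qed
  from this[of "Poly_Mapping.keys f"] assms(1) show ?thesis by (simp add: word_algebra_expand)
qed

lemma scale_mult:
  fixes f g :: "('l, 'x) bword \<Rightarrow>\<^sub>0 'k::comm_ring_1"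
  shows "scale c f * g = scale c (f * g)" "f * scale c g = scale c (f * g)"
proof -
  show "scale c f * g = scale c (f * g)" by (simp add: scale_conv_mult mult.assoc)
  \<comment> \<open>Scaling is left multiplication by a constant on the empty word. Moving it past a
    left factor needs that such constants are central, which is checked on words.\<close>
  have "f * Poly_Mapping.single [] c = scale c f"
    using subset_UNIV[of "Poly_Mapping.keys f"]
    by (induction f rule: word_algebra_induct[where W = UNIV])
      (simp_all add: scale_distrib distrib_left distrib_right scale_conv_mult mon_def mult_single plus_list_def mult.commute)
  then show "f * scale c g = scale c (f * g)" by (simp add: scale_conv_mult flip: mult.assoc)
qed

definition linear_map :: "((('l, 'x) bword \<Rightarrow>\<^sub>0 'k::comm_ring_1) \<Rightarrow> (('m, 'y) bword \<Rightarrow>\<^sub>0 'k)) \<Rightarrow> bool" where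
  "linear_map T \<longleftrightarrow> (\<forall>f g. T (f + g) = T f + T g) \<and> (\<forall>c f. T (scale c f) = scale c (T f))"

lemma linear_mapD:
  assumes "linear_map T"
  shows "T (f + g) = T f + T g" "T (scale c f) = scale c (T f)" "T 0 = 0" "T (- f) = - T f"
    "T (f - g) = T f - T g"
proof -
  show add: "T (f + g) = T f + T g" for f g
    using assms by (auto simp: linear_map_def)
  show sc: "T (scale c f) = scale c (T f)" for c f
    using assms by (auto simp: linear_map_def)
  show "T 0 = 0" using add[of 0 0] by simp
  show m: "T (- f) = - T f" for f using sc[of "- 1" f] by (simp add: scale_minus_one)
  show "T (f - g) = T f - T g" using add[of f "- g"] m by simp
qed

lemma linear_map_eqI:
  assumes "linear_map T" "linear_map T'" "\<And>u. u \<in> W \<Longrightarrow> T (mon u) = T' (mon u)"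
    and "Poly_Mapping.keys f \<subseteq> W"
  shows "T f = T' f"
  using assms(4)
  by (induction f rule: word_algebra_induct) (simp_all add: linear_mapD[OF assms(1)] linear_mapD[OF assms(2)] assms(3))

text \<open>In contrast to \<open>lin_ext\<close>, words may be sent to arbitrary elements. The
  product below needs this, since its values on words are sums of words.\<close>

definition linear_extension ::
  "(('l, 'x) bword \<Rightarrow> (('m, 'y) bword \<Rightarrow>\<^sub>0 'k)) \<Rightarrow> (('l, 'x) bword \<Rightarrow>\<^sub>0 'k) \<Rightarrow> ('m, 'y) bword \<Rightarrow>\<^sub>0 'k::comm_ring_1"
  where "linear_extension \<phi> f = (\<Sum>u\<in>Poly_Mapping.keys f. scale (Poly_Mapping.lookup f u) (\<phi> u))"

lemma linear_extension_superset:
  "finite F \<Longrightarrow> Poly_Mapping.keys f \<subseteq> F \<Longrightarrow>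
    linear_extension \<phi> f = (\<Sum>u\<in>F. scale (Poly_Mapping.lookup f u) (\<phi> u))"
  unfolding linear_extension_def by (rule sum.mono_neutral_left) (auto simp: not_in_keys_iff_lookup_eq_zero)

lemma linear_linear_extension:
  fixes \<phi> :: "('a, 'b) bword \<Rightarrow> (('c, 'd) bword \<Rightarrow>\<^sub>0 'e::comm_ring_1)"
  shows "linear_map (linear_extension \<phi>)"
  unfolding linear_map_def
proof (intro conjI allI)
  fix f g :: "('a, 'b) bword \<Rightarrow>\<^sub>0 'e"
  let ?F = "Poly_Mapping.keys f \<union> Poly_Mapping.keys g"
  show "linear_extension \<phi> (f + g) = linear_extension \<phi> f + linear_extension \<phi> g"
    using keys_add[of f g]
    by (simp add: linear_extension_superset[of ?F] lookup_add scale_distrib sum.distrib)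
next
  fix c and f :: "('a, 'b) bword \<Rightarrow>\<^sub>0 'e"
  show "linear_extension \<phi> (scale c f) = scale c (linear_extension \<phi> f)"
    using keys_scale[of c f]
    by (simp add: linear_extension_superset[of "Poly_Mapping.keys f"] scale_sum)
qed

lemma linear_extension_mon [simp]: "linear_extension \<phi> (mon u) = \<phi> u"
  by (simp add: linear_extension_def lookup_mon)

lemma lin_ext_eq: "lin_ext \<phi> = linear_extension (\<lambda>u. mon (\<phi> u))"
  by (auto simp: lin_ext_def linear_extension_def)

lemma bracket_mon [simp]: "bracket l (mon u) = mon [Bracket l u]"
  and plug_mon [simp]: "plug q (mon u) = mon (subst q u)"
  and linear_bracket: "linear_map (bracket l)"
  and linear_plug: "linear_map (plug q)"
  by (simp_all add: bracket_def plug_def lin_ext_eq linear_linear_extension)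

lemma linear_intros:
  "linear_map T \<Longrightarrow> linear_map (\<lambda>f. bracket l (T f))"
  "linear_map T \<Longrightarrow> linear_map (\<lambda>f. plug q (T f))"
  "linear_map T \<Longrightarrow> linear_map (\<lambda>f. linear_extension \<phi> (T f))"
  "linear_map T \<Longrightarrow> linear_map (\<lambda>f. T f * h)"
  "linear_map T \<Longrightarrow> linear_map (\<lambda>f. h * T f)"
  "linear_map T \<Longrightarrow> linear_map T' \<Longrightarrow> linear_map (\<lambda>f. T f + T' f)"
  "linear_map T \<Longrightarrow> linear_map T' \<Longrightarrow> linear_map (\<lambda>f. T f - T' f)"
  "linear_map (\<lambda>f. f)"
  using linear_bracket[of l] linear_plug[of q] linear_linear_extension[of \<phi>]
  by (auto simp: linear_map_def scale_distrib scale_mult distrib_left distrib_right)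

text \<open>Plugging into a context unwinds into brackets and multiplications by words, which are
  the operations under which an operated ideal is closed.\<close>

lemma plug_simps:
  "plug [Letter None] f = f"
  "plug [Bracket l q] f = bracket l (plug q f)"
  "plug (lift_word a @ q) f = mon a * plug q f"
  "plug (q @ lift_word b) f = plug q f * mon b"
  by (rule linear_map_eqI[where W = UNIV]; (intro linear_intros)?; simp)+

lemma keys_linear_image:
  assumes "linear_map T" "\<And>u. u \<in> W \<Longrightarrow> Poly_Mapping.keys (T (mon u)) \<subseteq> V" "Poly_Mapping.keys f \<subseteq> W"
  shows "Poly_Mapping.keys (T f) \<subseteq> V"
  using assms(3)
proof (induction f rule: word_algebra_induct)
  case (add f g)
  then show ?case using keys_add[of "T f" "T g"] by (auto simp: linear_mapD(1)[OF assms(1)])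
next
  case (mon c u)
  then show ?case using keys_scale[of c "T (mon u)"] assms(2) by (auto simp: linear_mapD(2)[OF assms(1)])
qed (simp add: linear_mapD[OF assms(1)])

lemma keys_closed:
  fixes f g :: "('l, 'x) bword \<Rightarrow>\<^sub>0 'k::comm_ring_1"
  assumes "Poly_Mapping.keys f \<subseteq> bwords \<X>"
  shows "Poly_Mapping.keys (bracket l f) \<subseteq> bwords \<X>" "Poly_Mapping.keys (scale c f) \<subseteq> bwords \<X>"
    "Poly_Mapping.keys (- f) \<subseteq> bwords \<X>"
    "Poly_Mapping.keys g \<subseteq> bwords \<X> \<Longrightarrow> Poly_Mapping.keys (f + g) \<subseteq> bwords \<X>"
    "Poly_Mapping.keys g \<subseteq> bwords \<X> \<Longrightarrow> Poly_Mapping.keys (f - g) \<subseteq> bwords \<X>"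
    "Poly_Mapping.keys g \<subseteq> bwords \<X> \<Longrightarrow> Poly_Mapping.keys (f * g) \<subseteq> bwords \<X>"
proof -
  show "Poly_Mapping.keys (bracket l f) \<subseteq> bwords \<X>"
    by (rule keys_linear_image[OF linear_bracket _ assms]) simp
  show "Poly_Mapping.keys (scale c f) \<subseteq> bwords \<X>" "Poly_Mapping.keys (- f) \<subseteq> bwords \<X>"
    "Poly_Mapping.keys g \<subseteq> bwords \<X> \<Longrightarrow> Poly_Mapping.keys (f + g) \<subseteq> bwords \<X>"
    "Poly_Mapping.keys g \<subseteq> bwords \<X> \<Longrightarrow> Poly_Mapping.keys (f - g) \<subseteq> bwords \<X>"
    using assms by (auto simp: in_keys_iff lookup_add lookup_minus) (metis add_0 diff_self subsetD in_keys_iff mult_zero_right)+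
  show "Poly_Mapping.keys (f * g) \<subseteq> bwords \<X>" if "Poly_Mapping.keys g \<subseteq> bwords \<X>"
    using keys_mult[of f g] assms that by (fastforce simp: plus_list_def)
qed

section \<open>The order\<close>

lemma db_less_wdeg: "db_less rX rL u v \<Longrightarrow> wdeg u \<le> wdeg v"
  by (cases rule: db_less.cases) auto

text \<open>Words and primes of bounded degree are shown to be well-founded alternately: words of degree below
  \<open>n\<close> compare as words over primes of degree below \<open>n\<close>, and brackets of degree at most \<open>n\<close> contain
  words of degree below \<open>n\<close>.\<close>

lemma wf_db_less_step:
  assumes "wf {(p, p'). pdeg p' < n \<and> db_less_prime rX rL p p'}"
  shows "wf {(u, v). wdeg v < n \<and> db_less rX rL u v}"
proof -
  let ?P = "{(p, p'). pdeg p' < n \<and> db_less_prime rX rL p p'}"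
  have "{(u, v). wdeg v < n \<and> db_less rX rL u v} \<subseteq>
      inv_image (less_than <*lex*> lenlex ?P) (\<lambda>u. (wdeg u, u))"
    by (auto elim!: db_less.cases simp: lenlex_conv intro!: lex_append_leftI)
  then show ?thesis
    by (rule wf_subset[rotated]) (intro wf_inv_image wf_lex_prod wf_less_than wf_lenlex assms)
qed

lemma wf_db_less_prime_step:
  assumes "wf (rX - Id)" "wf (rL - Id)" "wf {(u, v). wdeg v < n \<and> db_less rX rL u v}"
  shows "wf {(p, p'). pdeg p' < Suc n \<and> db_less_prime rX rL p p'}"
proof -
  let ?W = "{(u, v). wdeg v < n \<and> db_less rX rL u v}"
  \<comment> \<open>Letters use the third slot and brackets the last two. A slot that does not apply
    to brackets or letters holds a constant, so it never decides a comparison of two primes of the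
    same kind; the second slot puts letters below brackets of equal degree.\<close>
  define key where "key p =
    (case p of Letter x \<Rightarrow> (pdeg p, 0::nat, x, undefined, []) | Bracket l u \<Rightarrow> (pdeg p, 1, undefined, l, u))"
    for p :: "('b, 'a) bprime"
  have "{(p, p'). pdeg p' < Suc n \<and> db_less_prime rX rL p p'} \<subseteq>
      inv_image (less_than <*lex*> less_than <*lex*> (rX - Id) <*lex*> (rL - Id) <*lex*> ?W) key"
    by (auto elim!: db_less_prime.cases simp: key_def strictly_def split: bprime.splits)
  then show ?thesis
    by (rule wf_subset[rotated]) (intro wf_inv_image wf_lex_prod wf_less_than assms)
qed

lemma wf_db_less:
  assumes "wf (rX - Id)" "wf (rL - Id)"
  shows "wf {(u, v). db_less rX rL u v}"
proof -
  have P: "wf {(p, p'). pdeg p' < n \<and> db_less_prime rX rL p p'}" for n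
    by (induction n) (auto intro: wf_db_less_prime_step wf_db_less_step assms)
  show ?thesis
  proof (rule wfI_min)
    fix v and Q :: "('b, 'a) bword set"
    assume v: "v \<in> Q"
    from wf_db_less_step[OF P[of "Suc (wdeg v)"]]
    have "wf {(u, v'). wdeg v' < Suc (wdeg v) \<and> db_less rX rL u v'}" .
    \<comment> \<open>Predecessors never have larger degree, so a minimal word among those of
      \<open>Q\<close> of degree at most \<open>wdeg v\<close> is minimal in all of
      \<open>Q\<close>.\<close>
    from wfE_min[OF this, of v "Q \<inter> {u. wdeg u \<le> wdeg v}"] v
    obtain z where "z \<in> Q" "wdeg z \<le> wdeg v"
      "\<And>u. db_less rX rL u z \<Longrightarrow> u \<notin> Q \<inter> {u. wdeg u \<le> wdeg v}" by auto
    then show "\<exists>z\<in>Q. \<forall>u. (u, z) \<in> {(u, v). db_less rX rL u v} \<longrightarrow> u \<notin> Q"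
      using db_less_wdeg order_trans by (intro bexI[of _ z]) blast+
  qed
qed

lemma db_less_total:
  assumes rX: "total_on \<X> rX" and rL: "total_on UNIV rL" and "u \<in> bwords \<X>" "v \<in> bwords \<X>"
  shows "u = v \<or> db_less rX rL u v \<or> db_less rX rL v u"
  using assms(3,4)
proof (induction "wdeg u" arbitrary: u v rule: less_induct)
  case less
  note intros = db_less_db_less_prime.intros
  \<comment> \<open>The contents of a bracket occurring in \<open>u\<close> have smaller degree than
    \<open>u\<close>, so the induction hypothesis compares the contents of two brackets.\<close>
  have prime: "p = p' \<or> db_less_prime rX rL p p' \<or> db_less_prime rX rL p' p"
    if "p \<in> set u" "p' \<in> set v" for p p'
  proof (cases "pdeg p = pdeg p'")
    case True
    have mem: "p \<in> bprimes \<X>" "p' \<in> bprimes \<X>" using that less.prems by (auto simp: bwords_eq)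
    show ?thesis
    proof (cases p; cases p')
      fix l a m b
      assume p: "p = Bracket l a" "p' = Bracket m b"
      have "wdeg a < wdeg u" using pdeg_le_wdeg[OF that(1)] p by simp
      with less.hyps mem p have "a = b \<or> db_less rX rL a b \<or> db_less rX rL b a" by simp
      moreover have "l = m \<or> strictly rL l m \<or> strictly rL m l"
        using rL by (auto simp: total_on_def strictly_def)
      ultimately show ?thesis using True by (auto simp: p intro: intros)
    qed (use True mem rX in \<open>auto simp: total_on_def intro: intros letter_letter[unfolded strictly_def]\<close>)
  next
    case False
    then consider "pdeg p < pdeg p'" | "pdeg p' < pdeg p" by linarith
    then show ?thesis by cases (auto intro: prime_deg)
  qed
  show ?case
  proof (cases "u = v \<or> wdeg u \<noteq> wdeg v \<or> length u \<noteq> length v")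
    case True
    then show ?thesis using intros(1,2)[of u v rX rL] intros(1,2)[of v u rX rL] by linarith
  next
    case False
    then obtain t p u' p' v' where "p \<noteq> p'" "u = t @ [p] @ u'" "v = t @ [p'] @ v'"
      using same_length_different[of u v] by blast
    then have eq: "p \<noteq> p'" "u = t @ p # u'" "v = t @ p' # v'" by simp_all
    with prime[of p p'] consider "db_less_prime rX rL p p'" | "db_less_prime rX rL p' p" by auto
    then show ?thesis using False eq by cases (auto intro: intros)
  qed
qed

section \<open>Compatibility of the order with contexts\<close>

lemma db_less_context:
  assumes "db_less rX rL u v"
  shows "db_less rX rL (a @ u @ b) (a @ v @ b)"
  using assms
proof (cases rule: db_less.cases)
  case (less_factor t p u' p' v')
  then show ?thesis
    using db_less_db_less_prime.less_factor[of "a @ t" p "u' @ b" p' "v' @ b" rX rL] by simp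
qed (auto intro: db_less_db_less_prime.intros)

lemma db_less_bracket:
  assumes "db_less rX rL u v"
  shows "db_less rX rL [Bracket l u] [Bracket l v]"
proof (cases "wdeg u = wdeg v")
  case True
  with assms have "db_less_prime rX rL (Bracket l u) (Bracket l v)"
    by (intro bracket_arg) auto
  with True db_less_db_less_prime.less_factor[of "[]" "Bracket l u" "[]" "Bracket l v" "[]" rX rL]
  show ?thesis by simp
next
  case False
  with db_less_wdeg[OF assms] show ?thesis by (auto intro: db_less_db_less_prime.intros)
qed

lemma db_less_subst:
  "q \<in> star_words \<X> \<Longrightarrow> db_less rX rL u v \<Longrightarrow> db_less rX rL (subst q u) (subst q v)"
proof (induction q rule: star_words_induct)
  case (star a b)
  then show ?case using db_less_context by simp
next
  case (bracket a l r b)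
  then show ?case using db_less_context[OF db_less_bracket, of rX rL "subst r u" "subst r v" a l b] by simp
qed

locale db_ordered_words =
  fixes \<X> :: "'x set" and rX :: "'x rel" and rL :: "('o + 'o) rel" and r :: "('o + 'o, 'x) bword rel"
  assumes rX: "well_order_on \<X> rX" and rL: "well_order_on UNIV rL"
  defines "r \<equiv> db_order \<X> rX rL"
begin

lemma wf_less: "wf {(u, v). db_less rX rL u v}"
  using rX rL by (intro wf_db_less) (auto simp: well_order_on_def)

lemma less_asym: "db_less rX rL u v \<Longrightarrow> \<not> db_less rX rL v u"
  using wf_less by (metis case_prod_conv mem_Collect_eq wf_not_sym)

lemma less_total:
  "u \<in> bwords \<X> \<Longrightarrow> v \<in> bwords \<X> \<Longrightarrow> u = v \<or> db_less rX rL u v \<or> db_less rX rL v u"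
  using rX rL by (intro db_less_total) (auto simp: order_on_defs)

text \<open>Transitivity comes from totality: a failure would be a cycle of length three.\<close>

lemma less_trans:
  assumes "db_less rX rL u v" "db_less rX rL v w" "u \<in> bwords \<X>" "w \<in> bwords \<X>"
  shows "db_less rX rL u w"
proof (rule ccontr)
  assume "\<not> db_less rX rL u w"
  with less_total[of u w] assms less_asym have wu: "db_less rX rL w u" by blast
  obtain z where "z \<in> {u, v, w}" "\<And>y. db_less rX rL y z \<Longrightarrow> y \<notin> {u, v, w}"
    using wfE_min[OF wf_less, of u "{u, v, w}"] by auto
  with wu assms show False by auto
qed

lemma strictly_iff: "strictly r u v \<longleftrightarrow> u \<in> bwords \<X> \<and> v \<in> bwords \<X> \<and> db_less rX rL u v"
  using less_asym by (auto simp: strictly_def r_def db_order_def)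

lemma monomial: "monomial_order \<X> r"
  unfolding monomial_order_def order_on_defs
proof (intro conjI ballI allI impI)
  show "r \<subseteq> bwords \<X> \<times> bwords \<X>" "refl_on (bwords \<X>) r"
    by (auto simp: r_def db_order_def refl_on_def)
  show "trans r"
    unfolding trans_def r_def db_order_def using less_trans by blast
  show "antisym r"
    unfolding antisym_def r_def db_order_def using less_asym by blast
  show "total_on (bwords \<X>) r"
    unfolding total_on_def r_def db_order_def using less_total by blast
  show "wf (r - Id)"
    by (rule wf_subset[OF wf_less]) (auto simp: r_def db_order_def)
  show "strictly r (subst q u) (subst q v)" if "q \<in> star_words \<X>" "strictly r u v" for q u v
    using that by (auto simp: strictly_iff subst_in_bwords db_less_subst)
qed

lemma lead_eqI:
  assumes "Poly_Mapping.keys f \<subseteq> insert w V" "Poly_Mapping.lookup f w \<noteq> 0"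
    "\<And>v. v \<in> V \<Longrightarrow> strictly r v w" "w \<in> bwords \<X>"
  shows "lead r f = w"
  unfolding lead_def
proof (rule the_equality)
  have "(w, w) \<in> r" using assms(4) by (simp add: r_def db_order_def)
  with assms show w: "w \<in> Poly_Mapping.keys f \<and> (\<forall>v\<in>Poly_Mapping.keys f. (v, w) \<in> r)"
    by (auto simp: in_keys_iff strictly_def)
  fix w' assume w': "w' \<in> Poly_Mapping.keys f \<and> (\<forall>v\<in>Poly_Mapping.keys f. (v, w') \<in> r)"
  have "antisym r" using monomial by (simp add: monomial_order_def order_on_defs)
  with w w' show "w' = w" by (auto dest: antisymD)
qed

end

section \<open>The Groebner-Shirshov basis\<close>

lemma trivial_modulo_plug:
  assumes "s \<in> S" "q \<in> star_words \<X>" "strictly r (subst q (lead r s)) w"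
  shows "trivial_modulo \<X> r S w (plug q s)"
  unfolding trivial_modulo_def
  by (rule exI[of _ 1], rule exI[of _ "\<lambda>_. 1"], rule exI[of _ "\<lambda>_. q"], rule exI[of _ "\<lambda>_. s"])
    (use assms in auto)

lemma trivial_modulo_uminus:
  assumes "trivial_modulo \<X> r S w h"
  shows "trivial_modulo \<X> r S w (- h)"
proof -
  from assms obtain n :: nat and c q s where
    "\<forall>i<n. c i \<noteq> 0 \<and> q i \<in> star_words \<X> \<and> s i \<in> S \<and> strictly r (subst (q i) (lead r (s i))) w"
    "h = (\<Sum>i<n. scale (c i) (plug (q i) (s i)))"
    unfolding trivial_modulo_def by blast
  then show ?thesis
    unfolding trivial_modulo_def
    by (intro exI[of _ n] exI[of _ "\<lambda>i. - c i"] exI[of _ q] exI[of _ s])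
      (auto simp: sum_negf[symmetric] scale_sum simp flip: scale_minus_one)
qed

lemma trivial_modulo_add:
  fixes h h' :: "('a, 'b) bword \<Rightarrow>\<^sub>0 'c::comm_ring_1"
  assumes "trivial_modulo \<X> r S w h" "trivial_modulo \<X> r S w h'"
  shows "trivial_modulo \<X> r S w (h + h')"
proof -
  from assms(1) obtain n :: nat and c q s where
    1: "\<forall>i<n. c i \<noteq> 0 \<and> q i \<in> star_words \<X> \<and> s i \<in> S \<and> strictly r (subst (q i) (lead r (s i))) w"
    "h = (\<Sum>i<n. scale (c i) (plug (q i) (s i)))"
    unfolding trivial_modulo_def by blast
  from assms(2) obtain n' :: nat and c' q' s' where
    2: "\<forall>i<n'. c' i \<noteq> 0 \<and> q' i \<in> star_words \<X> \<and> s' i \<in> S \<and> strictly r (subst (q' i) (lead r (s' i))) w"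
    "h' = (\<Sum>i<n'. scale (c' i) (plug (q' i) (s' i)))"
    unfolding trivial_modulo_def by blast
  define C Q T where "C i = (if i < n then c i else c' (i - n))"
    and "Q i = (if i < n then q i else q' (i - n))"
    and "T i = (if i < n then s i else s' (i - n))" for i
  have "sum F {..<n + n'} = sum F {..<n} + (\<Sum>i<n'. F (n + i))"
    for F :: "nat \<Rightarrow> ('a, 'b) bword \<Rightarrow>\<^sub>0 'c"
    by (induction n') (simp_all add: add.assoc)
  then have "h + h' = (\<Sum>i<n + n'. scale (C i) (plug (Q i) (T i)))"
    by (simp add: 1(2) 2(2) C_def Q_def T_def)
  moreover have "\<forall>i<n + n'. C i \<noteq> 0 \<and> Q i \<in> star_words \<X> \<and> T i \<in> S \<and>
      strictly r (subst (Q i) (lead r (T i))) w"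
    using 1(1) 2(1) by (auto simp: C_def Q_def T_def)
  ultimately show ?thesis unfolding trivial_modulo_def by blast
qed

lemma trivial_modulo_diff:
  "trivial_modulo \<X> r S w h \<Longrightarrow> trivial_modulo \<X> r S w h' \<Longrightarrow> trivial_modulo \<X> r S w (h - h')"
  using trivial_modulo_add[OF _ trivial_modulo_uminus] by fastforce

section \<open>The two families of relations as one family\<close>

definition to_R :: "'o + 'o \<Rightarrow> 'o + 'o" where "to_R l = Inl (case_sum id id l)"
definition to_S :: "'o + 'o \<Rightarrow> 'o + 'o" where "to_S l = Inr (case_sum id id l)"

lemma to_R_S_simps [simp]:
  "isl (to_R l)" "\<not> isl (to_S l)" "to_R (to_R l) = to_R l" "to_R (to_S l) = to_R l"
  "to_S (to_R l) = to_S l" "to_S (to_S l) = to_S l" "to_R (Inl \<alpha>) = Inl \<alpha>" "to_R (Inr \<alpha>) = Inl \<alpha>"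
  "to_S (Inl \<alpha>) = Inr \<alpha>" "to_S (Inr \<alpha>) = Inr \<alpha>"
  by (simp_all add: to_R_def to_S_def)

text \<open>The definition is meant for \<open>isl l = isl m\<close>; the common side selects the
  family. Only the sides of the inner labels are forced, their indices are kept.\<close>

definition rb_relation ::
  "'o + 'o \<Rightarrow> 'o + 'o \<Rightarrow> ('o + 'o, 'x) bword \<Rightarrow> ('o + 'o, 'x) bword \<Rightarrow> ('o + 'o, 'x) bword \<Rightarrow>\<^sub>0 'k::comm_ring_1" where
  "rb_relation l m u v = mon [Bracket l u, Bracket m v]
     - mon [Bracket m (Bracket (to_R l) u # v)] - mon [Bracket l (u @ [Bracket (to_S m) v])]"

lemma S_MS_eq:
  "S_MS \<X> = {rb_relation l m u v | l m u v. isl l = isl m \<and> u \<in> bwords \<X> \<and> v \<in> bwords \<X>}"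
    (is "_ = ?S")
proof
  show "S_MS \<X> \<subseteq> ?S"
  proof
    fix f :: "('a + 'a, 'b) bword \<Rightarrow>\<^sub>0 'c" assume "f \<in> S_MS \<X>"
    then consider u v \<alpha> \<beta> where "f = rb_relation (Inl \<alpha>) (Inl \<beta>) u v" "u \<in> bwords \<X>" "v \<in> bwords \<X>"
      | u v \<alpha> \<beta> where "f = rb_relation (Inr \<alpha>) (Inr \<beta>) u v" "u \<in> bwords \<X>" "v \<in> bwords \<X>"
      unfolding S_MS_def rb_relation_def by auto
    then show "f \<in> ?S" by cases (simp, metis sum.disc)+
  qed
  show "?S \<subseteq> S_MS \<X>"
  proof
    fix f :: "('a + 'a, 'b) bword \<Rightarrow>\<^sub>0 'c" assume "f \<in> ?S"
    then obtain l m u v where "f = rb_relation l m u v" "isl l = isl m" "u \<in> bwords \<X>" "v \<in> bwords \<X>"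
      by blast
    note luv = this
    from luv(2) consider (R) \<alpha> \<beta> where "l = Inl \<alpha>" "m = Inl \<beta>" | (S) \<alpha> \<beta> where "l = Inr \<alpha>" "m = Inr \<beta>"
      by (cases l; cases m) auto
    then show "f \<in> S_MS \<X>"
    proof cases
      case R
      with luv show ?thesis unfolding S_MS_def rb_relation_def by (intro UnI1) auto
    next
      case S
      with luv show ?thesis unfolding S_MS_def rb_relation_def by (intro UnI2) auto
    qed
  qed
qed

lemma S_MS_keys:
  assumes "f \<in> S_MS \<X>"
  shows "Poly_Mapping.keys f \<subseteq> bwords \<X>"
proof -
  from assms obtain l m u v where "f = rb_relation l m u v" "u \<in> bwords \<X>" "v \<in> bwords \<X>"
    unfolding S_MS_eq by blast
  then show ?thesis by (simp only: rb_relation_def) (intro keys_closed(5); simp)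
qed

lemma rb_relation_in_S_MS:
  "isl l = isl m \<Longrightarrow> u \<in> bwords \<X> \<Longrightarrow> v \<in> bwords \<X> \<Longrightarrow> rb_relation l m u v \<in> S_MS \<X>"
  unfolding S_MS_eq by blast

section \<open>Resolution of the compositions\<close>

context db_ordered_words
begin

text \<open>The three words have equal degree, and breadth two stands against breadth one, so the
  orders on letters and operators never enter.\<close>

lemma lead_rb_relation:
  assumes "u \<in> bwords \<X>" "v \<in> bwords \<X>"
  shows "lead r (rb_relation l m u v :: _ \<Rightarrow>\<^sub>0 'k::comm_ring_1) = [Bracket l u, Bracket m v]"
    and "monic r (rb_relation l m u v :: _ \<Rightarrow>\<^sub>0 'k)"
proof -
  let ?f = "rb_relation l m u v :: _ \<Rightarrow>\<^sub>0 'k"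
  let ?V = "{[Bracket m (Bracket (to_R l) u # v)], [Bracket l (u @ [Bracket (to_S m) v])]}"
  have keys: "Poly_Mapping.keys ?f \<subseteq> insert [Bracket l u, Bracket m v] ?V"
    by (auto simp: rb_relation_def in_keys_iff lookup_minus lookup_mon split: if_splits)
  have coeff: "Poly_Mapping.lookup ?f [Bracket l u, Bracket m v] = 1"
    by (simp add: rb_relation_def lookup_minus lookup_mon)
  show lead: "lead r ?f = [Bracket l u, Bracket m v]"
    by (rule lead_eqI[OF keys]) (use assms in \<open>auto simp: coeff strictly_iff intro: less_breadth\<close>)
  show "monic r ?f"
    unfolding monic_def lead coeff using coeff by auto
qed

text \<open>Rewritings at nested positions commute. If the inner leading word sits in
  \<open>a\<close>, then rewriting it inside \<open>rb_relation l m a b\<close> yields relations of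
  the same labels with changed \<open>a\<close>, and rewriting it in the two subtracted words yields
  contexts of the inner relation. The composition is the difference of these. The case of
  \<open>b\<close> is symmetric.\<close>

lemma including_trivial:
  assumes f: "isl l = isl m" "a \<in> bwords \<X>" "b \<in> bwords \<X>"
    and g: "isl l' = isl m'" "a' \<in> bwords \<X>" "b' \<in> bwords \<X>"
    and ne: "rb_relation l m a b \<noteq> (rb_relation l' m' a' b' :: _ \<Rightarrow>\<^sub>0 'k)"
    and q: "q \<in> star_words \<X>" "[Bracket l a, Bracket m b] = subst q [Bracket l' a', Bracket m' b']"
  shows "trivial_modulo \<X> r (S_MS \<X>) [Bracket l a, Bracket m b]
    (rb_relation l m a b - plug q (rb_relation l' m' a' b' :: _ \<Rightarrow>\<^sub>0 'k::comm_ring_1))"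
proof -
  let ?G = "[Bracket l' a', Bracket m' b']" and ?g = "rb_relation l' m' a' b' :: _ \<Rightarrow>\<^sub>0 'k"
  let ?w = "[Bracket l a, Bracket m b]" and ?T = "trivial_modulo \<X> r (S_MS \<X>)"
  define G1 G2 where "G1 = [Bracket m' (Bracket (to_R l') a' # b')]"
    and "G2 = [Bracket l' (a' @ [Bracket (to_S m') b'])]"
  note lin = linear_mapD[OF linear_plug]
  have G: "G1 \<in> bwords \<X>" "G2 \<in> bwords \<X>" "strictly r G1 ?G" "strictly r G2 ?G"
    using g by (auto simp: G1_def G2_def strictly_iff intro!: less_breadth)
  have g_eq: "?g = mon ?G - mon G1 - mon G2"
    by (simp add: rb_relation_def G1_def G2_def)
  have gS: "?g \<in> S_MS \<X>" using g by (rule rb_relation_in_S_MS)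
  have T_plug: "?T ?w (plug q' ?g)" if "q' \<in> star_words \<X>" "strictly r (subst q' ?G) ?w" for q'
    using that g gS by (intro trivial_modulo_plug) (auto simp: lead_rb_relation)
  have T_rel: "?T ?w (rb_relation l m c d :: _ \<Rightarrow>\<^sub>0 'k)"
    if "c \<in> bwords \<X>" "d \<in> bwords \<X>" "strictly r [Bracket l c, Bracket m d] ?w" for c d
    using trivial_modulo_plug[of "rb_relation l m c d :: _ \<Rightarrow>\<^sub>0 'k" "S_MS \<X>" "[Letter None]" \<X> r ?w] that f
    by (simp add: plug_simps(1) lead_rb_relation rb_relation_in_S_MS)
  have mono: "strictly r (subst q' u) (subst q' v)" if "q' \<in> star_words \<X>" "strictly r u v" for q' u v
    using monomial that by (auto simp: monomial_order_def)
  from q(1) show ?thesis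
  proof (cases rule: star_words_cases)
    case (star c d)
    \<comment> \<open>A star at top level would make the two leading words equal. Since a leading
      word determines labels and contents, the relations would coincide.\<close>
    then have "c = [] \<and> d = []" using arg_cong[OF q(2), of length] by simp
    with star q(2) ne show ?thesis by auto
  next
    case (bracket c k q' d)
    with q(2) consider "c = []" "d = [Bracket m b]" "k = l" "a = subst q' ?G"
      | "c = [Bracket l a]" "d = []" "k = m" "b = subst q' ?G"
      by (cases c) (auto simp: Cons_eq_append_conv)
    then show ?thesis
    proof cases
      case 1
      then have q_eq: "q = [Bracket l q'] @ lift_word [Bracket m b]" using bracket by simp
      \<comment> \<open>These are the positions of \<open>?G\<close> in the two subtracted words of
        \<open>rb_relation l m a b\<close>. Filled with \<open>?G\<close>, they have the degree of
        \<open>?w\<close> but breadth one.\<close>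
      let ?q1 = "[Bracket m ([Bracket (to_R l) q'] @ lift_word b)]"
      let ?q2 = "[Bracket l (q' @ lift_word [Bracket (to_S m) b])]"
      have "rb_relation l m a b - plug q ?g = rb_relation l m (subst q' G1) b
          + rb_relation l m (subst q' G2) b - plug ?q1 ?g - plug ?q2 ?g"
        unfolding g_eq q_eq by (simp add: rb_relation_def lin 1(4) algebra_simps)
      \<comment> \<open>Breadth does not help here, as \<open>?w\<close> and its rewritten form both
        have breadth two. The bound comes from monotonicity in the context \<open>q\<close>.\<close>
      moreover have "?T ?w (rb_relation l m (subst q' H) b :: _ \<Rightarrow>\<^sub>0 'k)"
        if "H \<in> bwords \<X>" "strictly r H ?G" for H
        using mono[of q H ?G] that q bracket f by (intro T_rel) (auto simp: q_eq 1(4) subst_in_bwords)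
      moreover have "?T ?w (plug ?q1 ?g)"
        by (rule T_plug) (use bracket f g 1(4) in \<open>auto intro!: less_breadth simp: strictly_iff star_words_iff lift_word_props\<close>)
      moreover have "?T ?w (plug ?q2 ?g)"
        by (rule T_plug) (use bracket f g 1(4) in \<open>auto intro!: less_breadth simp: strictly_iff star_words_iff lift_word_props\<close>)
      ultimately show ?thesis
        using G by (auto intro!: trivial_modulo_add trivial_modulo_diff)
    next
      case 2
      then have q_eq: "q = lift_word [Bracket l a] @ [Bracket m q']" using bracket by simp
      let ?q1 = "[Bracket m (lift_word [Bracket (to_R l) a] @ q')]"
      let ?q2 = "[Bracket l (lift_word a @ [Bracket (to_S m) q'])]"
      have "rb_relation l m a b - plug q ?g = rb_relation l m a (subst q' G1)
          + rb_relation l m a (subst q' G2) - plug ?q1 ?g - plug ?q2 ?g"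
        unfolding g_eq q_eq by (simp add: rb_relation_def lin 2(4) algebra_simps)
      moreover have "?T ?w (rb_relation l m a (subst q' H) :: _ \<Rightarrow>\<^sub>0 'k)"
        if "H \<in> bwords \<X>" "strictly r H ?G" for H
        using mono[of q H ?G] that q bracket f by (intro T_rel) (auto simp: q_eq 2(4) subst_in_bwords)
      moreover have "?T ?w (plug ?q1 ?g)"
        by (rule T_plug) (use bracket f g 2(4) in \<open>auto intro!: less_breadth simp: strictly_iff star_words_iff lift_word_props\<close>)
      moreover have "?T ?w (plug ?q2 ?g)"
        by (rule T_plug) (use bracket f g 2(4) in \<open>auto intro!: less_breadth simp: strictly_iff star_words_iff lift_word_props\<close>)
      ultimately show ?thesis
        using G by (auto intro!: trivial_modulo_add trivial_modulo_diff)
    qed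
  qed
qed

text \<open>After each side is rewritten once more, the word with outer label \<open>m\<close>
  occurs twice and cancels. The words with outer label \<open>n\<close> form the relation of
  \<open>to_R l\<close> and \<open>to_R m\<close> in the context \<open>?q1\<close>, those with
  outer label \<open>l\<close> the relation of \<open>to_S m\<close> and \<open>to_S n\<close> in
  the context \<open>?q2\<close>. The six leading words, put into their contexts, have the degree of
  \<open>?w\<close> and breadth at most two.\<close>

lemma intersection_trivial:
  assumes lab: "isl l = isl m" "isl m = isl n"
    and abc: "a \<in> bwords \<X>" "b \<in> bwords \<X>" "c \<in> bwords \<X>"
  shows "trivial_modulo \<X> r (S_MS \<X>) [Bracket l a, Bracket m b, Bracket n c]
    (rb_relation l m a b * mon [Bracket n c] - mon [Bracket l a] * rb_relation m n b c :: _ \<Rightarrow>\<^sub>0 'k::comm_ring_1)"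
proof -
  let ?w = "[Bracket l a, Bracket m b, Bracket n c]" and ?T = "trivial_modulo \<X> r (S_MS \<X>)"
  note lin = linear_mapD[OF linear_plug]
  have T_plug: "?T ?w (plug q (rb_relation l' m' u v) :: _ \<Rightarrow>\<^sub>0 'k)"
    if "isl l' = isl m'" "u \<in> bwords \<X>" "v \<in> bwords \<X>" "q \<in> star_words \<X>"
      "strictly r (subst q [Bracket l' u, Bracket m' v]) ?w" for l' m' u v q
    using that by (intro trivial_modulo_plug) (auto simp: lead_rb_relation rb_relation_in_S_MS)
  let ?q1 = "[Bracket n ([Letter None] @ lift_word c)]" and ?q2 = "[Bracket l (lift_word a @ [Letter None])]"
  let ?rel = "\<lambda>l m u v. plug [Letter None] (rb_relation l m u v) :: _ \<Rightarrow>\<^sub>0 'k"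
  have "rb_relation l m a b * mon [Bracket n c] - mon [Bracket l a] * rb_relation m n b c =
      plug ?q1 (rb_relation (to_R l) (to_R m) a b) - plug ?q2 (rb_relation (to_S m) (to_S n) b c)
      - ?rel m n (Bracket (to_R l) a # b) c - ?rel l n (a @ [Bracket (to_S m) b]) c
      + ?rel l n a (Bracket (to_R m) b # c) + ?rel l m a (b @ [Bracket (to_S n) c])"
    by (simp add: plug_simps(1)) (simp add: rb_relation_def lin algebra_simps)
  moreover have "?T ?w (plug ?q1 (rb_relation (to_R l) (to_R m) a b :: _ \<Rightarrow>\<^sub>0 'k))"
      "?T ?w (plug ?q2 (rb_relation (to_S m) (to_S n) b c :: _ \<Rightarrow>\<^sub>0 'k))"
      "?T ?w (?rel m n (Bracket (to_R l) a # b) c)" "?T ?w (?rel l n (a @ [Bracket (to_S m) b]) c)"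
      "?T ?w (?rel l n a (Bracket (to_R m) b # c))" "?T ?w (?rel l m a (b @ [Bracket (to_S n) c]))"
    using lab abc by (auto intro!: T_plug less_breadth simp: strictly_iff star_words_iff lift_word_props)
  ultimately show ?thesis
    by (auto intro!: trivial_modulo_add trivial_modulo_diff)
qed

lemma groebner_shirshov: "groebner_shirshov_basis \<X> r (S_MS \<X> :: (_ \<Rightarrow>\<^sub>0 'k::comm_ring_1) set)"
  unfolding groebner_shirshov_basis_def
proof (intro conjI ballI allI impI)
  show "S_MS \<X> \<subseteq> carrier (free_operated_algebra \<X> :: ('k, ('o + 'o, 'x) bword \<Rightarrow>\<^sub>0 'k) module)"
    using S_MS_keys by (auto simp: free_operated_algebra_def)
  fix f :: "('o + 'o, 'x) bword \<Rightarrow>\<^sub>0 'k" assume "f \<in> S_MS \<X>"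
  then obtain l m a b where f: "f = rb_relation l m a b" "isl l = isl m" "a \<in> bwords \<X>" "b \<in> bwords \<X>"
    by (auto simp: S_MS_eq)
  then show "monic r f" by (simp add: lead_rb_relation)
  fix g w h
  assume "g \<in> S_MS \<X>"
    and fg: "f \<noteq> g \<and> (intersection_composition \<X> r f g w h \<or> including_composition \<X> r f g w h)"
  then obtain l' m' a' b' where g: "g = rb_relation l' m' a' b'" "isl l' = isl m'"
      "a' \<in> bwords \<X>" "b' \<in> bwords \<X>"
    by (auto simp: S_MS_eq)
  have lead: "lead r f = [Bracket l a, Bracket m b]" "lead r g = [Bracket l' a', Bracket m' b']"
    using f g by (simp_all add: lead_rb_relation)
  from fg consider "intersection_composition \<X> r f g w h" | "including_composition \<X> r f g w h" by blast
  then show "trivial_modulo \<X> r (S_MS \<X>) w h"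
  proof cases
    case 1
    then obtain u v where uv: "w = [Bracket l a, Bracket m b] @ u" "w = v @ [Bracket l' a', Bracket m' b']"
      and lw: "max (length [Bracket l a, Bracket m b]) (length [Bracket l' a', Bracket m' b']) < length w"
      "length w < length [Bracket l a, Bracket m b] + length [Bracket l' a', Bracket m' b']"
      and h: "h = f * mon u - mon v * g"
      unfolding intersection_composition_def lead by blast
    \<comment> \<open>Both leading words have breadth two, so the ambiguity has breadth three and
      the overlap is a single bracket.\<close>
    from lw have "2 < length w" "length w < 4" by simp_all
    moreover have "length w = length u + 2" by (subst uv(1)) simp
    moreover have "length w = length v + 2" by (subst uv(2)) simp
    ultimately have "length u = 1" "length v = 1" by linarith+
    then obtain x y where "u = [x]" "v = [y]" by (auto simp: length_Suc_conv)
    with uv h f g intersection_trivial[of l m m' a b b'] show ?thesis by auto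
  next
    case 2
    then obtain q where q: "q \<in> star_words \<X>" "w = [Bracket l a, Bracket m b]"
      "w = subst q [Bracket l' a', Bracket m' b']" "h = f - plug q g"
      unfolding including_composition_def lead by blast
    have "f \<noteq> g" using fg by blast
    then show ?thesis
      unfolding q(2,4) f(1) g(1)
      by (intro including_trivial f g q(1)) (simp_all add: q(3)[symmetric] q(2))
  qed
qed

end

section \<open>A product of Rota-Baxter type on the word algebra\<close>

text \<open>Reversing \<open>u\<close> gives access to its last factor. Each recursive call strips
  one of the two meeting brackets and changes only the side of the other, so the total degree
  drops.\<close>

function rb_prod ::
  "('o + 'o, 'x) bword \<Rightarrow> ('o + 'o, 'x) bword \<Rightarrow> ('o + 'o, 'x) bword \<Rightarrow>\<^sub>0 'k::comm_ring_1" where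
  "rb_prod u v = (case (rev u, v) of
      (Bracket l a # u', Bracket m b # v') \<Rightarrow>
        if isl l = isl m
        then mon (rev u') * (bracket m (rb_prod [Bracket (to_R l) a] b) + bracket l (rb_prod a [Bracket (to_S m) b])) * mon v'
        else mon (u @ v)
    | _ \<Rightarrow> mon (u @ v))"
  by auto
termination
proof (relation "Wellfounded.measure (\<lambda>(u, v). wdeg u + wdeg v)")
  have "wdeg (rev u) = wdeg u" for u :: "('o + 'o, 'x) bword" by (induction u) auto
  then have deg: "wdeg u = Suc (wdeg a) + wdeg u'" if "Bracket l a # u' = rev u"
    for u u' a :: "('o + 'o, 'x) bword" and l
    by (metis that wdeg_simps(2) pdeg_Bracket)
  show "(([Bracket (to_R l) a], b), u, v) \<in> Wellfounded.measure (\<lambda>(u, v). wdeg u + wdeg v)"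
    "((a, [Bracket (to_S m) b]), u, v) \<in> Wellfounded.measure (\<lambda>(u, v). wdeg u + wdeg v)"
    if "(x, y) = (rev u, v)" "x = xp # u'" "xp = Bracket l a" "y = yp # v'" "yp = Bracket m b" "isl l = isl m"
    for u v x y u' v' a b :: "('o + 'o, 'x) bword" and xp yp l m
    using that deg[of l a u' u] by auto
qed simp

declare rb_prod.simps [simp del]

lemma rb_prod_Nil [simp]: "rb_prod [] v = mon v" "rb_prod u [] = mon u"
  by (simp_all add: rb_prod.simps split: list.splits bprime.splits)

definition interact :: "('o + 'o, 'x) bprime \<Rightarrow> ('o + 'o, 'x) bprime \<Rightarrow> bool" where
  "interact p p' \<longleftrightarrow> (\<exists>l m a b. p = Bracket l a \<and> p' = Bracket m b \<and> isl l = isl m)"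

lemma interact_simps [simp]:
  "\<not> interact (Letter x) p" "\<not> interact p (Letter x)"
  "interact (Bracket l a) (Bracket m b) \<longleftrightarrow> isl l = isl m"
  by (auto simp: interact_def)

lemma rb_prod_bracket:
  "isl l = isl m \<Longrightarrow> rb_prod [Bracket l a] [Bracket m b] =
    bracket m (rb_prod [Bracket (to_R l) a] b) + bracket l (rb_prod a [Bracket (to_S m) b])"
  by (subst rb_prod.simps) simp

lemma rb_prod_concat:
  "\<not> interact p p' \<Longrightarrow> rb_prod [p] [p'] = mon [p, p']"
  by (subst rb_prod.simps) (auto split: bprime.splits)

text \<open>Locality of the product: everything away from the meeting pair is carried along by
  concatenation. The treatment of longer words rests on this.\<close>

lemma rb_prod_snoc_Cons: "rb_prod (u @ [p]) (p' # v) = mon u * rb_prod [p] [p'] * mon v"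
  by (subst (1 2) rb_prod.simps) (auto split: bprime.splits)

lemma rb_prod_Cons_right: "rb_prod u (p' # v) = rb_prod u [p'] * mon v"
  by (cases u rule: rev_cases) (simp_all add: rb_prod_snoc_Cons[of _ _ _ "[]"] rb_prod_snoc_Cons)

lemma rb_prod_snoc_left: "rb_prod (u @ [p]) v = mon u * rb_prod [p] v"
proof (cases v)
  case (Cons p' v')
  then show ?thesis
    by (simp add: rb_prod_snoc_Cons rb_prod_Cons_right[of "[p]" p' v'] mult.assoc)
qed simp

section \<open>Bilinear extension and associativity of the product\<close>

definition rb_mult ::
  "(('o + 'o, 'x) bword \<Rightarrow>\<^sub>0 'k) \<Rightarrow> (('o + 'o, 'x) bword \<Rightarrow>\<^sub>0 'k) \<Rightarrow> ('o + 'o, 'x) bword \<Rightarrow>\<^sub>0 'k::comm_ring_1"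
  (infixl \<open>\<diamond>\<close> 70) where
  "f \<diamond> g = linear_extension (\<lambda>u. linear_extension (rb_prod u) g) f"

lemma linear_rb_mult_left: "linear_map (\<lambda>f. f \<diamond> g)"
  unfolding rb_mult_def by (rule linear_linear_extension)

lemma linear_rb_mult_right: "linear_map (\<lambda>g. f \<diamond> g)"
proof -
  have sum: "linear_map (\<lambda>g. \<Sum>u\<in>F. T u g)" if "\<And>u. linear_map (T u)"
    for F :: "('a + 'a, 'b) bword set" and T :: "_ \<Rightarrow> (('a + 'a, 'b) bword \<Rightarrow>\<^sub>0 'c) \<Rightarrow> ('a + 'a, 'b) bword \<Rightarrow>\<^sub>0 'c"
    using that by (auto simp: linear_map_def sum.distrib scale_sum)
  have scale: "linear_map (\<lambda>g. scale c (T g))" if "linear_map T"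
    for c and T :: "(('a + 'a, 'b) bword \<Rightarrow>\<^sub>0 'c) \<Rightarrow> ('a + 'a, 'b) bword \<Rightarrow>\<^sub>0 'c"
    using that by (auto simp: linear_map_def scale_distrib mult.commute)
  show ?thesis
    unfolding rb_mult_def linear_extension_def[of _ f]
    by (intro sum scale linear_linear_extension)
qed

lemma rb_mult_mon [simp]: "mon u \<diamond> mon v = rb_prod u v"
  by (simp add: rb_mult_def)

lemmas rb_mult_linear = linear_mapD[OF linear_rb_mult_left] linear_mapD[OF linear_rb_mult_right]

lemma linear_rb_mult_intros:
  assumes "linear_map T"
  shows "linear_map (\<lambda>f. T f \<diamond> h)" "linear_map (\<lambda>f. h \<diamond> T f)"
  using assms by (simp_all add: linear_map_def rb_mult_linear)

lemmas all_linear_intros = linear_intros linear_rb_mult_intros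

lemma linear_map_ext:
  "linear_map T \<Longrightarrow> linear_map T' \<Longrightarrow> (\<And>u. T (mon u) = T' (mon u)) \<Longrightarrow> T f = T' f"
  by (rule linear_map_eqI[where W = UNIV]) auto

lemma rb_mult_one: "mon [] \<diamond> f = f" "f \<diamond> mon [] = f"
  by (rule linear_map_ext; (intro all_linear_intros)?; simp)+

lemma rb_mult_snoc_left: "mon (u @ [p]) \<diamond> f = mon u * (mon [p] \<diamond> f)"
  by (rule linear_map_ext[of "\<lambda>f. mon (u @ [p]) \<diamond> f"]; (intro all_linear_intros)?; simp add: rb_prod_snoc_left)

lemma rb_mult_Cons_right: "f \<diamond> mon (p # v) = (f \<diamond> mon [p]) * mon v"
  by (rule linear_map_ext[of "\<lambda>f. f \<diamond> mon (p # v)"]; (intro all_linear_intros)?; simp)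
    (subst rb_prod_Cons_right, rule refl)

text \<open>Whatever \<open>f\<close> is, each word of \<open>f * mon (u @ [p])\<close> ends in
  \<open>p\<close>, so all summands have the same meeting pair.\<close>

lemma rb_mult_long_left: "(f * mon (u @ [p])) \<diamond> mon (p' # v) = f * mon u * rb_prod [p] [p'] * mon v"
  by (rule linear_map_ext[of "\<lambda>f. (f * mon (u @ [p])) \<diamond> mon (p' # v)"]; (intro all_linear_intros)?)
    (simp add: rb_prod_snoc_Cons flip: append_assoc)

lemma rb_mult_long_right: "mon (u @ [p]) \<diamond> (mon (p' # v) * f) = mon u * rb_prod [p] [p'] * mon v * f"
  by (rule linear_map_ext[of "\<lambda>f. mon (u @ [p]) \<diamond> (mon (p' # v) * f)"]; (intro all_linear_intros)?)
    (simp add: rb_prod_snoc_Cons mult.assoc)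

lemma rb_mult_bracket:
  assumes "isl l = isl m"
  shows "bracket l f \<diamond> bracket m g =
    bracket m (bracket (to_R l) f \<diamond> g) + bracket l (f \<diamond> bracket (to_S m) g)"
proof (rule linear_map_ext[of _ _ f])
  fix u
  show "bracket l (mon u) \<diamond> bracket m g =
    bracket m (bracket (to_R l) (mon u) \<diamond> g) + bracket l (mon u \<diamond> bracket (to_S m) g)"
    by (rule linear_map_ext[of _ _ g]; (intro all_linear_intros)?) (simp add: rb_prod_bracket[OF assms])
qed (intro all_linear_intros)+

text \<open>Each word on the left ends in a bracket labelled \<open>l\<close>. Its contents vary
  with \<open>f\<close>, but it always separates \<open>u\<close> from the meeting point.\<close>

lemma rb_mult_bracket_left:
  "(mon u * bracket l f) \<diamond> g = mon u * (bracket l f \<diamond> g)"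
  by (rule linear_map_ext[of _ _ f]; (intro all_linear_intros)?) (simp add: rb_mult_snoc_left)

text \<open>Interaction depends on the sides of the labels only, so one choice of contents
  \<open>a\<close> decides it for every word of \<open>f\<close>.\<close>

lemma rb_mult_bracket_concat_left:
  assumes "\<not> interact p (Bracket l a)"
  shows "mon [p] \<diamond> bracket l f = mon [p] * bracket l f"
proof -
  have "\<not> interact p (Bracket l u)" for u using assms by (cases p) auto
  note concat = rb_prod_concat[OF this]
  show ?thesis
    by (rule linear_map_ext[of _ _ f]; (intro all_linear_intros)?) (simp add: concat)
qed

lemma rb_mult_bracket_concat_right:
  assumes "\<not> interact (Bracket l a) p"
  shows "bracket l f \<diamond> mon [p] = bracket l f * mon [p]"
proof -
  have "\<not> interact (Bracket l u) p" for u using assms by (cases p) auto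
  note concat = rb_prod_concat[OF this]
  show ?thesis
    by (rule linear_map_ext[of _ _ f]; (intro all_linear_intros)?) (simp add: concat)
qed

lemma interact_cases [case_names concat bracket]:
  obtains "\<not> interact p p'"
  | l m a b where "p = Bracket l a" "p' = Bracket m b" "isl l = isl m"
  unfolding interact_def by blast

text \<open>Induction on the total degree, with a split on the breadth of the middle word. Two or
  more factors there keep the interactions at its two ends apart. A single factor leaves three
  primes that meet, and if both pairs interact, the nested products have smaller degree.\<close>

lemma rb_prod_assoc:
  fixes u v w :: "('o + 'o, 'x) bword"
  shows "(rb_prod u v :: _ \<Rightarrow>\<^sub>0 'k::comm_ring_1) \<diamond> mon w = mon u \<diamond> rb_prod v w"
proof (induction "wdeg u + wdeg v + wdeg w" arbitrary: u v w rule: less_induct)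
  case less
  \<comment> \<open>The bound is not strict because the three primes may be all of \<open>u\<close>,
    \<open>v\<close> and \<open>w\<close>. The induction hypothesis is applied only after a bracket
    has been stripped.\<close>
  have triple: "(rb_prod [p] [q] :: _ \<Rightarrow>\<^sub>0 'k) \<diamond> mon [s] = mon [p] \<diamond> rb_prod [q] [s]"
    if deg: "pdeg p + pdeg q + pdeg s \<le> wdeg u + wdeg v + wdeg w" for p q s :: "('o + 'o, 'x) bprime"
  proof (cases p q rule: interact_cases)
    case concat
    then have pq: "rb_prod [p] [q] = (mon [p, q] :: _ \<Rightarrow>\<^sub>0 'k)" "\<not> interact p q"
      by (simp_all add: rb_prod_concat)
    show ?thesis
    proof (cases q s rule: interact_cases)
      case concat
      then show ?thesis
        using pq rb_mult_snoc_left[of "[p]" q "mon [s] :: _ \<Rightarrow>\<^sub>0 'k"]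
          rb_mult_Cons_right[of "mon [p] :: _ \<Rightarrow>\<^sub>0 'k" q "[s]"]
        by (simp add: rb_prod_concat)
    next
      case (bracket l m b c)
      \<comment> \<open>The summands of \<open>rb_prod [q] [s]\<close> are brackets labelled
        \<open>l\<close> or \<open>m\<close>, both on the side of \<open>q\<close>, so
        \<open>p\<close> interacts with none of them.\<close>
      with pq(2) have "\<not> interact p (Bracket l b)" "\<not> interact p (Bracket m c)"
        by (auto simp: interact_def)
      with bracket have "(mon [p] :: _ \<Rightarrow>\<^sub>0 'k) \<diamond> rb_prod [q] [s] = mon [p] * rb_prod [q] [s]"
        by (simp add: rb_prod_bracket rb_mult_linear distrib_left rb_mult_bracket_concat_left)
      then show ?thesis using pq rb_mult_snoc_left[of "[p]" q "mon [s] :: _ \<Rightarrow>\<^sub>0 'k"] by simp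
    qed
  next
    case pq: (bracket l m a b)
    show ?thesis
    proof (cases q s rule: interact_cases)
      case concat
      with pq have "\<not> interact (Bracket l a) s" "\<not> interact (Bracket m b) s"
        by (auto simp: interact_def)
      with pq have "(rb_prod [p] [q] :: _ \<Rightarrow>\<^sub>0 'k) \<diamond> mon [s] = rb_prod [p] [q] * mon [s]"
        by (simp add: rb_prod_bracket rb_mult_linear distrib_right rb_mult_bracket_concat_right)
      then show ?thesis
        using concat rb_mult_Cons_right[of "mon [p] :: _ \<Rightarrow>\<^sub>0 'k" q "[s]"] by (simp add: rb_prod_concat)
    next
      case (bracket m' n b' c)
      with pq have qs: "s = Bracket n c" "isl m = isl n" by auto
      have IH: "((mon x :: _ \<Rightarrow>\<^sub>0 'k) \<diamond> mon y) \<diamond> mon z = mon x \<diamond> (mon y \<diamond> mon z)"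
        if "wdeg x + wdeg y + wdeg z < Suc (Suc (Suc (wdeg a + wdeg b + wdeg c)))"
        for x y z :: "('o + 'o, 'x) bword"
        using less[of x y z] deg that pq qs by simp
      have "((mon [p] :: _ \<Rightarrow>\<^sub>0 'k) \<diamond> mon [q]) \<diamond> mon [s] =
          (bracket l (mon a) \<diamond> bracket m (mon b)) \<diamond> bracket n (mon c)"
        using pq qs by simp
      \<comment> \<open>Expanding the left side gives four terms. The two with outer label
        \<open>n\<close> are the expansion of the product of the brackets labelled
        \<open>to_R l\<close> and \<open>to_R m\<close>.\<close>
      also have "\<dots> =
          bracket n ((bracket (to_R l) (mon a) \<diamond> bracket (to_R m) (mon b)) \<diamond> mon c)
          + bracket m ((bracket (to_R l) (mon a) \<diamond> mon b) \<diamond> bracket (to_S n) (mon c))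
          + bracket l ((mon a \<diamond> bracket (to_S m) (mon b)) \<diamond> bracket (to_S n) (mon c))"
        using pq qs by (simp only: rb_mult_bracket to_R_S_simps rb_mult_linear linear_mapD[OF linear_bracket])
          (simp only: ac_simps)
      \<comment> \<open>Each of the three inner triples has lost exactly one bracket, so the
        induction hypothesis covers all of them.\<close>
      also have "\<dots> =
          bracket n (bracket (to_R l) (mon a) \<diamond> (bracket (to_R m) (mon b) \<diamond> mon c))
          + bracket m (bracket (to_R l) (mon a) \<diamond> (mon b \<diamond> bracket (to_S n) (mon c)))
          + bracket l (mon a \<diamond> (bracket (to_S m) (mon b) \<diamond> bracket (to_S n) (mon c)))"
        unfolding bracket_mon
        by (simp add: IH del: rb_mult_mon)
      \<comment> \<open>The mirror image of the first expansion: now the two terms with outer label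
        \<open>l\<close> combine, by the relation of \<open>to_S m\<close> and
        \<open>to_S n\<close>.\<close>
      also have "\<dots> = bracket l (mon a) \<diamond> (bracket m (mon b) \<diamond> bracket n (mon c))"
        using pq qs by (simp only: rb_mult_bracket to_R_S_simps rb_mult_linear linear_mapD[OF linear_bracket])
          (simp only: ac_simps)
      finally show ?thesis using pq qs by simp
    qed
  qed
  show ?case
  proof (cases "u = [] \<or> v = [] \<or> w = []")
    case True
    then show ?thesis by (auto simp: rb_mult_one)
  next
    case False
    then obtain u' p s w' where uw: "u = u' @ [p]" "w = s # w'"
      by (metis neq_Nil_conv rev_exhaust)
    show ?thesis
    proof (cases "\<exists>q. v = [q]")
      case True
      then obtain q where v: "v = [q]" by blast
      have "(rb_prod u v :: _ \<Rightarrow>\<^sub>0 'k) \<diamond> mon w = ((mon u' * rb_prod [p] [q]) \<diamond> mon [s]) * mon w'"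
        using rb_mult_Cons_right[of _ s w'] by (simp add: uw v rb_prod_snoc_left)
      also have "((mon u' :: _ \<Rightarrow>\<^sub>0 'k) * rb_prod [p] [q]) \<diamond> mon [s] = mon u' * (rb_prod [p] [q] \<diamond> mon [s])"
      proof (cases p q rule: interact_cases)
        case concat
        then show ?thesis
          using rb_mult_snoc_left[of "u' @ [p]" q "mon [s] :: _ \<Rightarrow>\<^sub>0 'k"]
            rb_mult_snoc_left[of "[p]" q "mon [s] :: _ \<Rightarrow>\<^sub>0 'k"]
          by (simp add: rb_prod_concat)
      next
        case (bracket l m a b)
        then show ?thesis
          by (simp add: rb_prod_bracket distrib_left rb_mult_linear rb_mult_bracket_left)
      qed
      also have "(rb_prod [p] [q] :: _ \<Rightarrow>\<^sub>0 'k) \<diamond> mon [s] = mon [p] \<diamond> rb_prod [q] [s]"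
        by (rule triple) (simp add: uw v)
      also have "(mon u' :: _ \<Rightarrow>\<^sub>0 'k) * (mon [p] \<diamond> rb_prod [q] [s]) = mon u \<diamond> rb_prod [q] [s]"
        by (simp add: uw rb_mult_snoc_left)
      also have "((mon u :: _ \<Rightarrow>\<^sub>0 'k) \<diamond> rb_prod [q] [s]) * mon w' = mon u \<diamond> (rb_prod [q] [s] * mon w')"
      proof (cases q s rule: interact_cases)
        case concat
        then show ?thesis
          using rb_mult_Cons_right[of "mon u :: _ \<Rightarrow>\<^sub>0 'k" q "s # w'"]
            rb_mult_Cons_right[of "mon u :: _ \<Rightarrow>\<^sub>0 'k" q "[s]"]
          by (simp add: rb_prod_concat mult.assoc)
      next
        case (bracket l m a b)
        have "((mon u :: _ \<Rightarrow>\<^sub>0 'k) \<diamond> bracket k f) * mon w' = mon u \<diamond> (bracket k f * mon w')" for k f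
          by (rule linear_map_ext[of _ _ f]; (intro all_linear_intros)?)
            (simp, subst (2) rb_prod_Cons_right, rule refl)
        with bracket show ?thesis
          by (simp add: rb_prod_bracket distrib_left distrib_right rb_mult_linear)
      qed
      also have "\<dots> = mon u \<diamond> rb_prod v w"
        by (simp add: uw v rb_prod_Cons_right[of "[q]" s w'])
      finally show ?thesis .
    next
      case no_single: False
      \<comment> \<open>The first factor \<open>q\<close> meets \<open>p\<close> and the last factor
        \<open>q'\<close> meets \<open>s\<close>, at different places, so both sides become the same
        concatenation of two products of primes.\<close>
      with False obtain q v' q' where v: "v = q # v' @ [q']"
        by (metis neq_Nil_conv rev_exhaust append_Cons)
      have "(rb_prod u v :: _ \<Rightarrow>\<^sub>0 'k) = mon u' * rb_prod [p] [q] * mon (v' @ [q'])"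
        by (simp add: uw v rb_prod_snoc_Cons)
      then have "(rb_prod u v :: _ \<Rightarrow>\<^sub>0 'k) \<diamond> mon w =
          mon u' * rb_prod [p] [q] * mon v' * rb_prod [q'] [s] * mon w'"
        by (simp add: uw rb_mult_long_left)
      moreover have "(rb_prod v w :: _ \<Rightarrow>\<^sub>0 'k) = mon (q # v') * (rb_prod [q'] [s] * mon w')"
        by (simp add: uw v mult.assoc rb_prod_snoc_Cons[of "q # v'" q' s w', simplified])
      then have "(mon u :: _ \<Rightarrow>\<^sub>0 'k) \<diamond> rb_prod v w =
          mon u' * rb_prod [p] [q] * mon v' * (rb_prod [q'] [s] * mon w')"
        by (simp only: uw rb_mult_long_right)
      ultimately show ?thesis by (simp add: mult.assoc)
    qed
  qed
qed

lemma rb_mult_assoc: "(f \<diamond> g) \<diamond> h = f \<diamond> (g \<diamond> h)"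
proof (rule linear_map_ext[of _ _ f])
  fix u
  show "(mon u \<diamond> g) \<diamond> h = mon u \<diamond> (g \<diamond> h)"
  proof (rule linear_map_ext[of _ _ g])
    fix v
    show "(mon u \<diamond> mon v) \<diamond> h = mon u \<diamond> (mon v \<diamond> h)"
      by (rule linear_map_ext[of _ _ h]; (intro all_linear_intros)?) (simp add: rb_prod_assoc)
  qed (intro all_linear_intros)+
qed (intro all_linear_intros)+

text \<open>The carrier also contains words with letters outside \<X>. The system serves only as a
  target of evaluation, so its product needs no closure conditions.\<close>

definition rb_algebra :: "('k::comm_ring_1, ('o + 'o, 'x) bword \<Rightarrow>\<^sub>0 'k) module" where
  "rb_algebra = \<lparr>carrier = UNIV, monoid.mult = (\<diamond>), one = mon [], zero = 0, add = (+), module.smult = scale\<rparr>"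

lemma rb_algebra_simps [simp]:
  "carrier rb_algebra = UNIV" "monoid.mult rb_algebra = (\<diamond>)" "one rb_algebra = mon []"
  "zero rb_algebra = 0" "add rb_algebra = (+)" "module.smult rb_algebra = scale"
  by (simp_all add: rb_algebra_def)

lemma ring_of_type_algebra_simps [simp]:
  "carrier ring_of_type_algebra = UNIV" "monoid.mult ring_of_type_algebra = (*)"
  "one ring_of_type_algebra = 1" "zero ring_of_type_algebra = 0" "add ring_of_type_algebra = (+)"
  by (simp_all add: ring_of_type_algebra_def)

lemma assoc_algebraI:
  fixes A :: "('k::comm_ring_1, 'a) module"
  assumes "ring A"
    and "\<And>c a. a \<in> carrier A \<Longrightarrow> c \<odot>\<^bsub>A\<^esub> a \<in> carrier A"
    and "\<And>c d a. a \<in> carrier A \<Longrightarrow> (c + d) \<odot>\<^bsub>A\<^esub> a = c \<odot>\<^bsub>A\<^esub> a \<oplus>\<^bsub>A\<^esub> d \<odot>\<^bsub>A\<^esub> a"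
    and "\<And>c a b. a \<in> carrier A \<Longrightarrow> b \<in> carrier A \<Longrightarrow> c \<odot>\<^bsub>A\<^esub> (a \<oplus>\<^bsub>A\<^esub> b) = c \<odot>\<^bsub>A\<^esub> a \<oplus>\<^bsub>A\<^esub> c \<odot>\<^bsub>A\<^esub> b"
    and "\<And>c d a. a \<in> carrier A \<Longrightarrow> (c * d) \<odot>\<^bsub>A\<^esub> a = c \<odot>\<^bsub>A\<^esub> (d \<odot>\<^bsub>A\<^esub> a)"
    and "\<And>a. a \<in> carrier A \<Longrightarrow> 1 \<odot>\<^bsub>A\<^esub> a = a"
    and "\<And>c a b. a \<in> carrier A \<Longrightarrow> b \<in> carrier A \<Longrightarrow> (c \<odot>\<^bsub>A\<^esub> a) \<otimes>\<^bsub>A\<^esub> b = c \<odot>\<^bsub>A\<^esub> (a \<otimes>\<^bsub>A\<^esub> b)"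
    and "\<And>c a b. a \<in> carrier A \<Longrightarrow> b \<in> carrier A \<Longrightarrow> a \<otimes>\<^bsub>A\<^esub> (c \<odot>\<^bsub>A\<^esub> b) = c \<odot>\<^bsub>A\<^esub> (a \<otimes>\<^bsub>A\<^esub> b)"
  shows "assoc_algebra A"
proof -
  interpret ring A by fact
  have "module ring_of_type_algebra A"
    by (rule moduleI) (use assms cring_from_type_algebra is_abelian_group in auto)
  with assms show ?thesis
    by (auto intro!: assoc_algebra.intro assoc_algebra_axioms.intro)
qed

lemma rb_algebra_matching_RB_system:
  "matching_RB_system (rb_algebra :: ('k::comm_ring_1, ('o + 'o, 'x) bword \<Rightarrow>\<^sub>0 'k) module)
    (\<lambda>\<omega>. bracket (Inl \<omega>)) (\<lambda>\<omega>. bracket (Inr \<omega>))"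
proof -
  let ?A = "rb_algebra :: ('k, ('o + 'o, 'x) bword \<Rightarrow>\<^sub>0 'k) module"
  have "ring ?A"
  proof (rule ringI)
    show "abelian_group ?A"
      by (rule abelian_groupI) (auto simp: algebra_simps intro: exI[of _ "- _"])
    show "Group.monoid ?A"
      by (rule monoidI) (auto simp: rb_mult_assoc rb_mult_one)
  qed (auto simp: rb_mult_linear)
  then have "assoc_algebra ?A"
    by (rule assoc_algebraI) (auto simp: scale_distrib rb_mult_linear)
  then show ?thesis
    by (intro matching_RB_system.intro matching_RB_system_axioms.intro)
      (auto simp: linear_operators_def linear_mapD[OF linear_bracket] rb_mult_bracket)
qed

section \<open>Quotients of the free operated algebra\<close>

lemma free_operated_algebra_simps [simp]:
  "carrier (free_operated_algebra \<X>) = {f. Poly_Mapping.keys f \<subseteq> bwords \<X>}"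
  "monoid.mult (free_operated_algebra \<X>) = (*)" "one (free_operated_algebra \<X>) = 1"
  "zero (free_operated_algebra \<X>) = 0" "add (free_operated_algebra \<X>) = (+)"
  "module.smult (free_operated_algebra \<X>) = scale"
  by (simp_all add: free_operated_algebra_def)

text \<open>The unit of the word algebra is supported at the \<open>0\<close> of the monoid of
  lists, so membership of the unit in the carrier takes this form.\<close>

lemma zero_in_bwords [simp]: "0 \<in> bwords \<X>"
  by (simp add: zero_list_def)

lemma ring_free_operated_algebra: "ring (free_operated_algebra \<X> :: ('k::comm_ring_1, ('l, 'x) bword \<Rightarrow>\<^sub>0 'k) module)"
proof (rule ringI)
  show "abelian_group (free_operated_algebra \<X> :: ('k, ('l, 'x) bword \<Rightarrow>\<^sub>0 'k) module)"
    by (rule abelian_groupI) (auto simp: keys_closed algebra_simps intro!: exI[of _ "- _"])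
  show "Group.monoid (free_operated_algebra \<X> :: ('k, ('l, 'x) bword \<Rightarrow>\<^sub>0 'k) module)"
    by (rule monoidI) (auto simp: keys_closed[THEN subsetD] mult.assoc)
qed (auto simp: algebra_simps)

lemma a_inv_free_operated_algebra:
  assumes "Poly_Mapping.keys f \<subseteq> bwords \<X>"
  shows "\<ominus>\<^bsub>free_operated_algebra \<X>\<^esub> f = - f"
proof -
  interpret ring "free_operated_algebra \<X> :: ('c, ('a, 'b) bword \<Rightarrow>\<^sub>0 'c) module"
    by (rule ring_free_operated_algebra)
  show ?thesis by (rule minus_equality) (use assms keys_closed in auto)
qed

locale operated_quotient =
  fixes \<X> :: "'x set" and I :: "(('l, 'x) bword \<Rightarrow>\<^sub>0 'k::comm_ring_1) set"
  assumes ideal: "ideal I (free_operated_algebra \<X>)"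
    and bracket_closed: "f \<in> I \<Longrightarrow> bracket l f \<in> I"
begin

lemma ideal_zero: "0 \<in> I"
  and ideal_add: "f \<in> I \<Longrightarrow> g \<in> I \<Longrightarrow> f + g \<in> I"
  and ideal_uminus: "f \<in> I \<Longrightarrow> - f \<in> I"
  and ideal_mult: "f \<in> I \<Longrightarrow> Poly_Mapping.keys g \<subseteq> bwords \<X> \<Longrightarrow> g * f \<in> I"
    "f \<in> I \<Longrightarrow> Poly_Mapping.keys g \<subseteq> bwords \<X> \<Longrightarrow> f * g \<in> I"
proof -
  interpret ideal I "free_operated_algebra \<X>" by (rule ideal)
  have keys: "f \<in> I \<Longrightarrow> Poly_Mapping.keys f \<subseteq> bwords \<X>" for f using Icarr by simp
  show "0 \<in> I" using additive_subgroup.zero_closed[OF is_additive_subgroup] by simp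
  show "f \<in> I \<Longrightarrow> g \<in> I \<Longrightarrow> f + g \<in> I"
    using additive_subgroup.a_closed[OF is_additive_subgroup, of f g] by simp
  show "- f \<in> I" if "f \<in> I"
    using additive_subgroup.a_inv_closed[OF is_additive_subgroup that]
    by (simp add: a_inv_free_operated_algebra keys[OF that])
  show "f \<in> I \<Longrightarrow> Poly_Mapping.keys g \<subseteq> bwords \<X> \<Longrightarrow> g * f \<in> I"
    "f \<in> I \<Longrightarrow> Poly_Mapping.keys g \<subseteq> bwords \<X> \<Longrightarrow> f * g \<in> I"
    using I_l_closed[of f g] I_r_closed[of f g] by simp_all
qed

lemma ideal_scale:
  assumes "f \<in> I"
  shows "scale c f \<in> I"
proof -
  have "Poly_Mapping.keys (scale c (mon [] :: _ \<Rightarrow>\<^sub>0 'k)) \<subseteq> bwords \<X>"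
    by (rule keys_closed(2)) simp
  from ideal_mult(1)[OF assms this] show ?thesis by (simp add: scale_mult)
qed

text \<open>This turns a relation into a rewriting rule modulo the ideal at every position of a
  word.\<close>

lemma ideal_plug:
  assumes "q \<in> star_words \<X>" "f \<in> I"
  shows "plug q f \<in> I"
  using assms
proof (induction q rule: star_words_induct)
  case (star a b)
  then have "mon a * (f * mon b) \<in> I"
    by (simp add: ideal_mult del: mon_mult_left)
  then show ?case by (simp only: plug_simps)
next
  case (bracket a l r b)
  then have "mon a * (bracket l (plug r f) * mon b) \<in> I"
    by (simp add: ideal_mult bracket_closed del: mon_mult_left)
  then show ?case by (simp only: plug_simps)
qed

definition cls :: "(('l, 'x) bword \<Rightarrow>\<^sub>0 'k) \<Rightarrow> (('l, 'x) bword \<Rightarrow>\<^sub>0 'k) set" where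
  "cls f = I +>\<^bsub>free_operated_algebra \<X>\<^esub> f"

definition Q :: "('k, (('l, 'x) bword \<Rightarrow>\<^sub>0 'k) set) module" where
  "Q = quotient_algebra (free_operated_algebra \<X>) I"

lemma cls_eq: "cls f = {i + f | i. i \<in> I}"
  by (auto simp: cls_def a_r_coset_def')

lemma cls_eq_iff: "cls f = cls g \<longleftrightarrow> f - g \<in> I"
proof
  assume "cls f = cls g"
  moreover have "f \<in> cls f" using ideal_zero by (force simp: cls_eq)
  ultimately show "f - g \<in> I" by (auto simp: cls_eq)
next
  have sub: "cls f \<subseteq> cls g" if "f - g \<in> I" for f g
  proof
    fix h assume "h \<in> cls f"
    then obtain i where "i \<in> I" "h = (i + (f - g)) + g" by (auto simp: cls_eq)
    then show "h \<in> cls g"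
      using that ideal_add[of i "f - g"] unfolding cls_eq by blast
  qed
  assume "f - g \<in> I"
  with ideal_uminus[of "f - g"] have "cls f \<subseteq> cls g" "cls g \<subseteq> cls f" by (simp_all add: sub)
  then show "cls f = cls g" by blast
qed

text \<open>Stated for any additive map preserving \<open>I\<close>, since both the scalar
  multiplication and the brackets of the quotient are maps of this kind.\<close>

lemma induced_map_cls:
  assumes "\<And>f g. T (f + g) = T f + T g" "\<And>f. f \<in> I \<Longrightarrow> T f \<in> I"
  shows "induced_map (free_operated_algebra \<X>) I T (cls f) = cls (T f)"
proof -
  have "induced_map (free_operated_algebra \<X>) I T (cls f) = {i + (T j + T f) | i j. i \<in> I \<and> j \<in> I}"
    using assms(1) by (fastforce simp: induced_map_def set_add_def' cls_eq)
  also have "\<dots> = cls (T f)"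
  proof
    show "{i + (T j + T f) | i j. i \<in> I \<and> j \<in> I} \<subseteq> cls (T f)"
      using ideal_add assms(2) by (auto simp: cls_eq simp flip: add.assoc)
    have "T 0 = 0" using assms(1)[of 0 0] by simp
    then show "cls (T f) \<subseteq> {i + (T j + T f) | i j. i \<in> I \<and> j \<in> I}"
      using ideal_zero by (force simp: cls_eq)
  qed
  finally show ?thesis .
qed

lemma bracket_cls: "induced_map (free_operated_algebra \<X>) I (bracket l) (cls f) = cls (bracket l f)"
  by (rule induced_map_cls) (auto simp: linear_mapD[OF linear_bracket] bracket_closed)

text \<open>Sums and multiples of cosets need only that \<open>I\<close> is closed under them and so
  make sense for all elements. Products use absorption by \<open>I\<close>, which is available only
  against elements of the carrier; hence the extra conditions there.\<close>

lemma Q_simps: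
  "carrier Q = cls ` {f. Poly_Mapping.keys f \<subseteq> bwords \<X>}"
  "\<zero>\<^bsub>Q\<^esub> = cls 0" "\<one>\<^bsub>Q\<^esub> = cls 1" "cls f \<oplus>\<^bsub>Q\<^esub> cls g = cls (f + g)"
  "Poly_Mapping.keys f \<subseteq> bwords \<X> \<Longrightarrow> Poly_Mapping.keys g \<subseteq> bwords \<X> \<Longrightarrow>
    cls f \<otimes>\<^bsub>Q\<^esub> cls g = cls (f * g)"
  "c \<odot>\<^bsub>Q\<^esub> cls f = cls (scale c f)"
proof -
  interpret ideal I "free_operated_algebra \<X>" by (rule ideal)
  note defs = Q_def quotient_algebra_def ring.defs module.defs FactRing_def
  show "carrier Q = cls ` {f. Poly_Mapping.keys f \<subseteq> bwords \<X>}"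
    by (auto simp: defs A_RCOSETS_def' cls_eq a_r_coset_def')
  show "\<zero>\<^bsub>Q\<^esub> = cls 0" by (auto simp: defs cls_eq)
  show "\<one>\<^bsub>Q\<^esub> = cls 1" by (simp add: defs cls_def)
  show "cls f \<otimes>\<^bsub>Q\<^esub> cls g = cls (f * g)"
    if "Poly_Mapping.keys f \<subseteq> bwords \<X>" "Poly_Mapping.keys g \<subseteq> bwords \<X>"
    using that rcoset_mult_add[of f g] by (simp add: defs cls_def)
  show "c \<odot>\<^bsub>Q\<^esub> cls f = cls (scale c f)"
    by (simp add: defs) (rule induced_map_cls, auto simp: scale_distrib ideal_scale)
  have "cls f <+>\<^bsub>free_operated_algebra \<X>\<^esub> cls g = cls (f + g)"
  proof
    show "cls f <+>\<^bsub>free_operated_algebra \<X>\<^esub> cls g \<subseteq> cls (f + g)"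
    proof
      fix h assume "h \<in> cls f <+>\<^bsub>free_operated_algebra \<X>\<^esub> cls g"
      then obtain i j where "i \<in> I" "j \<in> I" "h = (i + j) + (f + g)"
        by (auto simp: set_add_def' cls_eq algebra_simps)
      then show "h \<in> cls (f + g)" using ideal_add by (auto simp: cls_eq)
    qed
    show "cls (f + g) \<subseteq> cls f <+>\<^bsub>free_operated_algebra \<X>\<^esub> cls g"
    proof
      fix h assume "h \<in> cls (f + g)"
      then obtain i where "i \<in> I" "h = (i + f) + (0 + g)"
        by (auto simp: cls_eq algebra_simps)
      then show "h \<in> cls f <+>\<^bsub>free_operated_algebra \<X>\<^esub> cls g"
        using ideal_zero unfolding set_add_def' cls_eq by fastforce
    qed
  qed
  then show "cls f \<oplus>\<^bsub>Q\<^esub> cls g = cls (f + g)" by (simp add: defs)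
qed

lemma assoc_algebra_Q: "assoc_algebra Q"
proof -
  have "ring Q"
  proof (rule ringI)
    show "abelian_group Q"
    proof (rule abelian_groupI)
      fix x assume "x \<in> carrier Q"
      then obtain f where f: "x = cls f" "Poly_Mapping.keys f \<subseteq> bwords \<X>" by (auto simp: Q_simps)
      have "cls (- f) \<in> carrier Q" using keys_closed(3)[OF f(2)] by (simp add: Q_simps)
      moreover have "cls (- f) \<oplus>\<^bsub>Q\<^esub> x = \<zero>\<^bsub>Q\<^esub>" by (simp add: f(1) Q_simps)
      ultimately show "\<exists>y\<in>carrier Q. y \<oplus>\<^bsub>Q\<^esub> x = \<zero>\<^bsub>Q\<^esub>" by blast
    qed (auto simp: Q_simps keys_closed algebra_simps)
    show "Group.monoid Q"
      by (rule monoidI) (auto simp: Q_simps keys_closed mult.assoc)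
  qed (auto simp: Q_simps keys_closed distrib_left distrib_right)
  then show ?thesis
    by (rule assoc_algebraI) (auto simp: Q_simps keys_closed scale_distrib scale_mult)
qed

lemma finsum_Q:
  assumes "finite F" "\<And>i. i \<in> F \<Longrightarrow> Poly_Mapping.keys (f i) \<subseteq> bwords \<X>"
  shows "(\<Oplus>\<^bsub>Q\<^esub>i\<in>F. cls (f i)) = cls (\<Sum>i\<in>F. f i)"
proof -
  interpret assoc_algebra Q by (rule assoc_algebra_Q)
  show ?thesis
    using assms by (induction F) (auto simp: Q_simps finsum_insert)
qed

end

section \<open>Evaluation of words in a matching Rota-Baxter system\<close>

locale matching_RB_evaluation = matching_RB_system B R S
  for B :: "('k::comm_ring_1, 'b) module" (structure) and R S :: "'o \<Rightarrow> 'b \<Rightarrow> 'b" +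
  fixes \<X> :: "'x set" and \<phi> :: "'x \<Rightarrow> 'b"
  assumes \<phi>_closed: "\<phi> \<in> \<X> \<rightarrow> carrier B"
begin

lemma \<phi>_closed' [simp]: "x \<in> \<X> \<Longrightarrow> \<phi> x \<in> carrier B"
  using \<phi>_closed by blast

definition opB :: "'o + 'o \<Rightarrow> 'b \<Rightarrow> 'b" where "opB = case_sum R S"

primrec eval_prime :: "('o + 'o, 'x) bprime \<Rightarrow> 'b" where
  "eval_prime (Letter x) = \<phi> x"
| "eval_prime (Bracket l u) = opB l (foldr (\<otimes>) (map eval_prime u) \<one>)"

definition eval_word :: "('o + 'o, 'x) bword \<Rightarrow> 'b" where
  "eval_word u = foldr (\<otimes>) (map eval_prime u) \<one>"

lemma eval_word_simps [simp]:
  "eval_word [] = \<one>" "eval_word (Letter x # u) = \<phi> x \<otimes> eval_word u"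
  "eval_word (Bracket l a # u) = opB l (eval_word a) \<otimes> eval_word u"
  by (simp_all add: eval_word_def)

lemma opB_linear:
  "a \<in> carrier B \<Longrightarrow> opB l a \<in> carrier B"
  "a \<in> carrier B \<Longrightarrow> b \<in> carrier B \<Longrightarrow> opB l (a \<oplus> b) = opB l a \<oplus> opB l b"
  "a \<in> carrier B \<Longrightarrow> opB l (c \<odot> a) = c \<odot> opB l a"
  using R_linear S_linear by (auto simp: linear_operators_def opB_def Pi_iff split: sum.splits)

lemma opB_mult:
  "isl l = isl m \<Longrightarrow> a \<in> carrier B \<Longrightarrow> b \<in> carrier B \<Longrightarrow>
    opB l a \<otimes> opB m b = opB m (opB (to_R l) a \<otimes> b) \<oplus> opB l (a \<otimes> opB (to_S m) b)"
  using R_mult S_mult by (cases l; cases m) (auto simp: opB_def)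

lemma eval_word_closed [simp]: "u \<in> bwords \<X> \<Longrightarrow> eval_word u \<in> carrier B"
  by (induction u rule: bword_induct) (simp_all add: opB_linear(1))

lemma eval_word_append:
  "u \<in> bwords \<X> \<Longrightarrow> v \<in> bwords \<X> \<Longrightarrow> eval_word (u @ v) = eval_word u \<otimes> eval_word v"
  by (induction u rule: bword_induct) (simp_all add: opB_linear(1) m_assoc)

definition evaluate :: "(('o + 'o, 'x) bword \<Rightarrow>\<^sub>0 'k) \<Rightarrow> 'b" where
  "evaluate f = (\<Oplus>u\<in>Poly_Mapping.keys f. Poly_Mapping.lookup f u \<odot> eval_word u)"

lemma smult_closed' [simp]: "a \<in> carrier B \<Longrightarrow> c \<odot> a \<in> carrier B"
  by (rule smult_closed) simp_all

lemma smult_zero [simp]: "a \<in> carrier B \<Longrightarrow> 0 \<odot> a = \<zero>"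
  using smult_l_null by simp

lemma smult_distrib:
  "a \<in> carrier B \<Longrightarrow> (c + d) \<odot> a = c \<odot> a \<oplus> d \<odot> a"
  "a \<in> carrier B \<Longrightarrow> b \<in> carrier B \<Longrightarrow> c \<odot> (a \<oplus> b) = c \<odot> a \<oplus> c \<odot> b"
  "a \<in> carrier B \<Longrightarrow> (c * d) \<odot> a = c \<odot> (d \<odot> a)"
  "a \<in> carrier B \<Longrightarrow> 1 \<odot> a = a"
  using smult_l_distr[of c d a] smult_r_distr[of c a b] smult_assoc1[of c d a] smult_one[of a] by simp_all

lemma evaluate_superset:
  assumes "finite F" "Poly_Mapping.keys f \<subseteq> F" "F \<subseteq> bwords \<X>"
  shows "evaluate f = (\<Oplus>u\<in>F. Poly_Mapping.lookup f u \<odot> eval_word u)"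
  unfolding evaluate_def
  by (rule add.finprod_mono_neutral_cong_left)
    (use assms in \<open>auto simp: not_in_keys_iff_lookup_eq_zero\<close>)

lemma evaluate_closed [simp]: "Poly_Mapping.keys f \<subseteq> bwords \<X> \<Longrightarrow> evaluate f \<in> carrier B"
  unfolding evaluate_def by (rule finsum_closed) auto

lemma evaluate_add:
  assumes "Poly_Mapping.keys f \<subseteq> bwords \<X>" "Poly_Mapping.keys g \<subseteq> bwords \<X>"
  shows "evaluate (f + g) = evaluate f \<oplus> evaluate g"
proof -
  let ?F = "Poly_Mapping.keys f \<union> Poly_Mapping.keys g"
  have F: "?F \<subseteq> bwords \<X>" using assms by blast
  have "evaluate (f + g) = (\<Oplus>u\<in>?F. Poly_Mapping.lookup f u \<odot> eval_word u \<oplus> Poly_Mapping.lookup g u \<odot> eval_word u)"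
    unfolding evaluate_superset[OF _ keys_add F, simplified] lookup_add
    by (rule finsum_cong) (use F in \<open>auto simp: smult_distrib simp_implies_def\<close>)
  also have "\<dots> = (\<Oplus>u\<in>?F. Poly_Mapping.lookup f u \<odot> eval_word u) \<oplus> (\<Oplus>u\<in>?F. Poly_Mapping.lookup g u \<odot> eval_word u)"
    by (rule finsum_addf) (use F in auto)
  also have "\<dots> = evaluate f \<oplus> evaluate g"
    using evaluate_superset[of ?F f] evaluate_superset[of ?F g] F by simp
  finally show ?thesis .
qed

lemma evaluate_scale:
  assumes "Poly_Mapping.keys f \<subseteq> bwords \<X>"
  shows "evaluate (scale c f) = c \<odot> evaluate f"
proof -
  have "evaluate (scale c f) = (\<Oplus>u\<in>Poly_Mapping.keys f. c \<odot> (Poly_Mapping.lookup f u \<odot> eval_word u))"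
    unfolding evaluate_superset[OF finite_keys keys_scale assms] lookup_scale
    by (rule finsum_cong) (use assms in \<open>auto simp: smult_distrib simp_implies_def\<close>)
  also have "\<dots> = c \<odot> evaluate f"
    unfolding evaluate_def by (rule finsum_smult_ldistr[symmetric]) (use assms in auto)
  finally show ?thesis .
qed

lemma evaluate_zero [simp]: "evaluate 0 = \<zero>"
  by (simp add: evaluate_def)

lemma evaluate_mon [simp]: "u \<in> bwords \<X> \<Longrightarrow> evaluate (mon u) = eval_word u"
  by (simp add: evaluate_def lookup_mon finsum_insert[of "{}", simplified] smult_distrib)

lemma evaluate_scale_mon [simp]: "u \<in> bwords \<X> \<Longrightarrow> evaluate (scale c (mon u)) = c \<odot> eval_word u"
  by (simp add: evaluate_scale)

lemma evaluate_mult: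
  assumes "Poly_Mapping.keys f \<subseteq> bwords \<X>" "Poly_Mapping.keys g \<subseteq> bwords \<X>"
  shows "evaluate (f * g) = evaluate f \<otimes> evaluate g"
  using assms(1)
proof (induction f rule: word_algebra_induct)
  case (mon c u)
  show ?case
    using assms(2)
  proof (induction g rule: word_algebra_induct)
    case (mon d v)
    with \<open>u \<in> bwords \<X>\<close> show ?case
      by (simp add: scale_mult eval_word_append smult_mult_left smult_mult_right mult.commute flip: smult_distrib(3))
  next
    case (add g h)
    moreover have "Poly_Mapping.keys (scale c (mon u)) \<subseteq> bwords \<X>"
      using mon keys_scale[of c "mon u"] by auto
    ultimately show ?case
      using \<open>u \<in> bwords \<X>\<close> by (simp add: distrib_left evaluate_add keys_closed r_distr)
  qed (use mon in simp)
next
  case (add f h)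
  then show ?case using assms(2) by (simp add: distrib_right evaluate_add keys_closed l_distr)
qed (use assms(2) in simp)

lemma evaluate_bracket:
  assumes "Poly_Mapping.keys f \<subseteq> bwords \<X>"
  shows "evaluate (bracket l f) = opB l (evaluate f)"
  using assms
proof (induction f rule: word_algebra_induct)
  case zero
  \<comment> \<open>Homogeneity for the scalar \<open>0\<close> shows that operators fix the zero
    element.\<close>
  have "opB l \<zero> = \<zero>" using opB_linear(3)[of \<zero> l 0] opB_linear(1)[of \<zero> l] by simp
  then show ?case by (simp add: linear_mapD[OF linear_bracket])
next
  case (add f g)
  then show ?case by (simp add: linear_mapD[OF linear_bracket] evaluate_add keys_closed opB_linear)
next
  case (mon c u)
  then show ?case by (simp add: linear_mapD[OF linear_bracket] opB_linear)
qed

lemma evaluate_uminus: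
  assumes "Poly_Mapping.keys f \<subseteq> bwords \<X>"
  shows "evaluate (- f) = \<ominus> evaluate f"
  using evaluate_add[of "- f" f] assms keys_closed(3)[OF assms] by (intro minus_equality[symmetric]) auto

lemma evaluate_rb_relation:
  assumes "isl l = isl m" "u \<in> bwords \<X>" "v \<in> bwords \<X>"
  shows "evaluate (rb_relation l m u v) = \<zero>"
proof -
  define h :: "_ \<Rightarrow>\<^sub>0 'k"
    where "h = mon [Bracket m (Bracket (to_R l) u # v)] + mon [Bracket l (u @ [Bracket (to_S m) v])]"
  have h: "Poly_Mapping.keys h \<subseteq> bwords \<X>"
    unfolding h_def using assms by (intro keys_closed(4)) auto
  have "evaluate (mon [Bracket l u, Bracket m v]) = evaluate h"
    using assms by (simp add: h_def evaluate_add eval_word_append opB_linear opB_mult)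
  moreover have "rb_relation l m u v = mon [Bracket l u, Bracket m v] + - h"
    by (simp add: rb_relation_def h_def)
  ultimately show ?thesis
    using assms h by (simp add: evaluate_add evaluate_uminus keys_closed(3) r_neg del: add_uminus_conv_diff evaluate_mon)
qed

text \<open>The kernel of evaluation is itself an ideal closed under the brackets and contains all
  relations, so it is one of the ideals being intersected.\<close>

lemma operated_ideal_eval_kernel:
  assumes "f \<in> operated_ideal \<X> (S_MS \<X>)"
  shows "evaluate f = \<zero>"
proof -
  let ?A = "free_operated_algebra \<X> :: ('k, ('o + 'o, 'x) bword \<Rightarrow>\<^sub>0 'k) module"
  let ?K = "{f. Poly_Mapping.keys f \<subseteq> bwords \<X> \<and> evaluate f = \<zero>}"
  interpret A: ring ?A by (rule ring_free_operated_algebra)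
  have "ideal ?K ?A"
  proof (rule idealI)
    show "ring ?A" by (rule ring_free_operated_algebra)
    show "subgroup ?K (add_monoid ?A)"
      by (rule A.add.subgroupI)
        (auto simp: evaluate_add evaluate_uminus keys_closed keys_closed[THEN subsetD] a_inv_free_operated_algebra
          simp flip: a_inv_def intro!: exI[of _ 0])
  qed (auto simp: evaluate_mult keys_closed keys_closed[THEN subsetD])
  moreover have "bracket l f \<in> ?K" if "f \<in> ?K" for f l
    using that opB_linear(3)[of \<zero> l 0] opB_linear(1)[of \<zero> l]
    by (auto simp: evaluate_bracket keys_closed keys_closed[THEN subsetD])
  moreover have "S_MS \<X> \<subseteq> ?K"
    by (intro subsetI CollectI conjI S_MS_keys) (auto simp: S_MS_eq evaluate_rb_relation)
  ultimately show ?thesis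
    using assms unfolding operated_ideal_def by blast
qed

end

section \<open>The free matching Rota-Baxter system\<close>

lemma operated_quotient_S_MS:
  "operated_quotient \<X> (operated_ideal \<X> (S_MS \<X> :: (('o + 'o, 'x) bword \<Rightarrow>\<^sub>0 'k::comm_ring_1) set))"
  and S_MS_subset_operated_ideal:
  "(S_MS \<X> :: (('o + 'o, 'x) bword \<Rightarrow>\<^sub>0 'k) set) \<subseteq> operated_ideal \<X> (S_MS \<X>)"
proof -
  let ?A = "free_operated_algebra \<X> :: ('k, ('o + 'o, 'x) bword \<Rightarrow>\<^sub>0 'k) module"
  interpret A: ring ?A by (rule ring_free_operated_algebra)
  define F where "F = {I. ideal I ?A \<and> (\<forall>l. \<forall>f\<in>I. bracket l f \<in> I) \<and> S_MS \<X> \<subseteq> I}"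
  have F: "ideal I ?A" "f \<in> I \<Longrightarrow> bracket l f \<in> I" "S_MS \<X> \<subseteq> I" if "I \<in> F" for I f l
    using that by (simp_all add: F_def)
  have eq: "operated_ideal \<X> (S_MS \<X>) = \<Inter>F"
    unfolding operated_ideal_def F_def by (rule refl)
  have "S_MS \<X> \<subseteq> carrier ?A" using S_MS_keys by auto
  \<comment> \<open>The intersection of a family of ideals is an ideal only if the family has a
    member; the whole carrier is one.\<close>
  then have "carrier ?A \<in> F"
    using A.oneideal unfolding F_def by (simp add: keys_closed(1))
  then have "F \<noteq> {}" by blast
  with F(1) have "ideal (\<Inter>F) ?A" by (intro A.i_Intersect)
  then show "operated_quotient \<X> (operated_ideal \<X> (S_MS \<X> :: (('o + 'o, 'x) bword \<Rightarrow>\<^sub>0 'k) set))"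
    unfolding eq using F(2) by (intro operated_quotient.intro) auto
  show "(S_MS \<X> :: (('o + 'o, 'x) bword \<Rightarrow>\<^sub>0 'k) set) \<subseteq> operated_ideal \<X> (S_MS \<X>)"
    unfolding eq using F(3) by blast
qed

locale matching_RB_quotient =
  fixes \<X> :: "'x set" and I :: "(('o + 'o, 'x) bword \<Rightarrow>\<^sub>0 'k::comm_ring_1) set"
  assumes I_eq: "I = operated_ideal \<X> (S_MS \<X>)"
begin

sublocale operated_quotient \<X> I
  unfolding I_eq by (rule operated_quotient_S_MS)

lemma Q_eq: "quotient_MS \<X> = Q"
  by (simp add: quotient_MS_def Q_def flip: I_eq)

lemma word_class_eq: "word_class \<X> w = cls (mon w)"
  by (simp add: word_class_def cls_def flip: I_eq)

lemma quotient_op_cls: "quotient_op \<X> l (cls f) = cls (bracket l f)"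
  unfolding quotient_op_def I_eq[symmetric] by (rule bracket_cls)

text \<open>The expression is linear in each argument separately, so it suffices to treat words,
  where it is a generator of the ideal.\<close>

lemma rb_relation_in_ideal:
  assumes "isl l = isl m" "Poly_Mapping.keys f \<subseteq> bwords \<X>" "Poly_Mapping.keys g \<subseteq> bwords \<X>"
  shows "bracket l f * bracket m g - bracket m (bracket (to_R l) f * g) - bracket l (f * bracket (to_S m) g) \<in> I"
    (is "?T f g \<in> I")
proof -
  have lin: "linear_map (\<lambda>f. ?T f g)" "linear_map (?T f)" for f g
    by (intro linear_intros linear_bracket; fail)+
  from assms(2) show ?thesis
  proof (induction f rule: word_algebra_induct)
    case (mon c u)
    from assms(3) have "?T (mon u) g \<in> I"
    proof (induction g rule: word_algebra_induct)
      case (mon d v)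
      have "?T (mon u) (mon v) = rb_relation l m u v"
        by (simp add: rb_relation_def)
      with mon \<open>u \<in> bwords \<X>\<close> rb_relation_in_S_MS[OF assms(1)] S_MS_subset_operated_ideal
      have "?T (mon u) (mon v) \<in> I" unfolding I_eq by fastforce
      then show ?case unfolding linear_mapD(2)[OF lin(2)] by (rule ideal_scale)
    next
      case (add g h)
      then show ?case unfolding linear_mapD(1)[OF lin(2)] by (intro ideal_add)
    next
      case zero
      show ?case unfolding linear_mapD(3)[OF lin(2)] by (rule ideal_zero)
    qed
    then show ?case unfolding linear_mapD(2)[OF lin(1)] by (rule ideal_scale)
  next
    case (add g h)
    then show ?case unfolding linear_mapD(1)[OF lin(1)] by (intro ideal_add)
  next
    case zero
    show ?case unfolding linear_mapD(3)[OF lin(1)] by (rule ideal_zero)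
  qed
qed

lemma quotient_rb_identity:
  assumes "isl l = isl m" "a \<in> carrier Q" "b \<in> carrier Q"
  shows "quotient_op \<X> l a \<otimes>\<^bsub>Q\<^esub> quotient_op \<X> m b =
    quotient_op \<X> m (quotient_op \<X> (to_R l) a \<otimes>\<^bsub>Q\<^esub> b) \<oplus>\<^bsub>Q\<^esub> quotient_op \<X> l (a \<otimes>\<^bsub>Q\<^esub> quotient_op \<X> (to_S m) b)"
proof -
  obtain f g where fg: "a = cls f" "b = cls g" "Poly_Mapping.keys f \<subseteq> bwords \<X>" "Poly_Mapping.keys g \<subseteq> bwords \<X>"
    using assms by (auto simp: Q_simps)
  then show ?thesis
    using rb_relation_in_ideal[OF assms(1), of f g]
    by (simp add: Q_simps quotient_op_cls keys_closed cls_eq_iff diff_diff_eq)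
qed

lemma quotient_matching_RB_system:
  "matching_RB_system Q (\<lambda>\<omega>. quotient_op \<X> (Inl \<omega>)) (\<lambda>\<omega>. quotient_op \<X> (Inr \<omega>))"
proof -
  have "quotient_op \<X> l \<in> linear_operators Q" for l
    by (auto simp: linear_operators_def Q_simps quotient_op_cls keys_closed linear_mapD[OF linear_bracket])
  moreover note assoc_algebra_Q
  moreover have "quotient_op \<X> (Inl \<alpha>) a \<otimes>\<^bsub>Q\<^esub> quotient_op \<X> (Inl \<beta>) b =
      quotient_op \<X> (Inl \<beta>) (quotient_op \<X> (Inl \<alpha>) a \<otimes>\<^bsub>Q\<^esub> b) \<oplus>\<^bsub>Q\<^esub>
      quotient_op \<X> (Inl \<alpha>) (a \<otimes>\<^bsub>Q\<^esub> quotient_op \<X> (Inr \<beta>) b)"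
    "quotient_op \<X> (Inr \<alpha>) a \<otimes>\<^bsub>Q\<^esub> quotient_op \<X> (Inr \<beta>) b =
      quotient_op \<X> (Inr \<beta>) (quotient_op \<X> (Inl \<alpha>) a \<otimes>\<^bsub>Q\<^esub> b) \<oplus>\<^bsub>Q\<^esub>
      quotient_op \<X> (Inr \<alpha>) (a \<otimes>\<^bsub>Q\<^esub> quotient_op \<X> (Inr \<beta>) b)"
    if "a \<in> carrier Q" "b \<in> carrier Q" for a b \<alpha> \<beta>
    using quotient_rb_identity[of "Inl \<alpha>" "Inl \<beta>", OF _ that] quotient_rb_identity[of "Inr \<alpha>" "Inr \<beta>", OF _ that]
    by simp_all
  ultimately show ?thesis
    by (intro matching_RB_system.intro matching_RB_system_axioms.intro)
qed

lemma quotient_free: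
  "free_matching_RB_system TYPE('b) \<X> (\<lambda>x. word_class \<X> [Letter x])
     Q (\<lambda>\<omega>. quotient_op \<X> (Inl \<omega>)) (\<lambda>\<omega>. quotient_op \<X> (Inr \<omega>))"
  unfolding free_matching_RB_system_def
proof (intro conjI allI impI)
  show "matching_RB_system Q (\<lambda>\<omega>. quotient_op \<X> (Inl \<omega>)) (\<lambda>\<omega>. quotient_op \<X> (Inr \<omega>))"
    by (rule quotient_matching_RB_system)
  show "(\<lambda>x. word_class \<X> [Letter x]) \<in> \<X> \<rightarrow> carrier Q"
    by (auto simp: word_class_eq Q_simps)
  fix B :: "('k, 'b) module" and R S :: "'o \<Rightarrow> 'b \<Rightarrow> 'b" and \<phi>
  assume B: "matching_RB_system B R S \<and> \<phi> \<in> \<X> \<rightarrow> carrier B"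
  interpret matching_RB_evaluation B R S \<X> \<phi>
    using B by (simp add: matching_RB_evaluation_def matching_RB_evaluation_axioms_def)
  let ?hom = "matching_RB_hom Q (\<lambda>\<omega>. quotient_op \<X> (Inl \<omega>)) (\<lambda>\<omega>. quotient_op \<X> (Inr \<omega>)) B R S"
  let ?P = "\<lambda>h. h \<in> extensional (carrier Q) \<and> h \<in> ?hom \<and> (\<forall>x\<in>\<X>. h (word_class \<X> [Letter x]) = \<phi> x)"
  \<comment> \<open>Cosets are evaluated at a chosen representative. The choice is harmless because
    two representatives differ by an element of the ideal, on which evaluation vanishes.\<close>
  define h where
    "h = restrict (\<lambda>C. evaluate (SOME f. Poly_Mapping.keys f \<subseteq> bwords \<X> \<and> C = cls f)) (carrier Q)"
  have h_cls: "h (cls f) = evaluate f" if f: "Poly_Mapping.keys f \<subseteq> bwords \<X>" for f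
  proof -
    define g where "g = (SOME g. Poly_Mapping.keys g \<subseteq> bwords \<X> \<and> cls f = cls g)"
    have g: "Poly_Mapping.keys g \<subseteq> bwords \<X> \<and> cls f = cls g"
      unfolding g_def by (rule someI[of _ f]) (simp add: f)
    then have "f - g \<in> operated_ideal \<X> (S_MS \<X>)" by (simp only: cls_eq_iff I_eq[symmetric])
    then have "evaluate (f - g) = \<zero>\<^bsub>B\<^esub>" by (rule operated_ideal_eval_kernel)
    moreover have "evaluate f = evaluate (f - g) \<oplus>\<^bsub>B\<^esub> evaluate g"
      using evaluate_add[of "f - g" g] f g by (simp add: keys_closed)
    ultimately have "evaluate f = evaluate g" using g by simp
    then show ?thesis using f by (auto simp: h_def Q_simps g_def)
  qed
  have op_R: "opB (Inl \<omega>) = R \<omega>" and op_S: "opB (Inr \<omega>) = S \<omega>" for \<omega> by (simp_all add: opB_def)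
  have "?P h"
  proof (intro conjI ballI)
    show "h \<in> extensional (carrier Q)" by (simp add: h_def)
    have "h \<in> ring_hom Q B"
      by (rule ring_hom_memI)
        (auto simp: Q_simps h_cls keys_closed evaluate_mult evaluate_add simp flip: mon_Nil)
    then show "h \<in> ?hom"
      by (auto simp: matching_RB_hom_def Q_simps h_cls keys_closed evaluate_scale evaluate_bracket
          quotient_op_cls op_R op_S)
    show "h (word_class \<X> [Letter x]) = \<phi> x" if "x \<in> \<X>" for x
      using that by (simp add: word_class_eq h_cls)
  qed
  moreover have "h' = h" if "?P h'" for h'
  proof (rule extensionalityI)
    show "h' \<in> extensional (carrier Q)" "h \<in> extensional (carrier Q)"
      using that \<open>?P h\<close> by blast+
    fix C assume "C \<in> carrier Q"
    then obtain f where f: "Poly_Mapping.keys f \<subseteq> bwords \<X>" "C = cls f" by (auto simp: Q_simps)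
    \<comment> \<open>Uniqueness: the values on generators force agreement with evaluation on words,
      by induction on their structure, and then everywhere by linearity.\<close>
    have hom: "h' \<in> ?hom" and gen: "\<And>x. x \<in> \<X> \<Longrightarrow> h' (cls (mon [Letter x])) = \<phi> x"
      using that by (auto simp: word_class_eq)
    have h'_add: "h' (cls (f + g)) = h' (cls f) \<oplus>\<^bsub>B\<^esub> h' (cls g)"
      and h'_mult: "h' (cls (f * g)) = h' (cls f) \<otimes>\<^bsub>B\<^esub> h' (cls g)"
      if "Poly_Mapping.keys f \<subseteq> bwords \<X>" "Poly_Mapping.keys g \<subseteq> bwords \<X>" for f g
      using that hom ring_hom_add[of h' Q B "cls f" "cls g"] ring_hom_mult[of h' Q B "cls f" "cls g"]
      by (auto simp: matching_RB_hom_def Q_simps)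
    have h'_one: "h' (cls 1) = \<one>\<^bsub>B\<^esub>"
      using hom ring_hom_one[of h' Q B] by (auto simp: matching_RB_hom_def Q_simps)
    have h'_scale: "h' (cls (scale c f)) = c \<odot>\<^bsub>B\<^esub> h' (cls f)"
      and h'_bracket: "h' (cls (bracket l f)) = opB l (h' (cls f))"
      if "Poly_Mapping.keys f \<subseteq> bwords \<X>" for c l f
      using that hom by (auto simp: matching_RB_hom_def Q_simps quotient_op_cls[symmetric] opB_def split: sum.splits)
    have word: "h' (cls (mon u)) = eval_word u" if "u \<in> bwords \<X>" for u
      using that
    proof (induction u rule: bword_induct)
      case Nil
      then show ?case by (simp add: h'_one mon_Nil)
    next
      case (Letter x u)
      then show ?case using h'_mult[of "mon [Letter x]" "mon u"] by (simp add: gen)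
    next
      case (Bracket l a u)
      then show ?case
        using h'_mult[of "mon [Bracket l a]" "mon u"] h'_bracket[of "mon a" l] by simp
    qed
    have "h' (cls f) = evaluate f"
      using f(1)
    proof (induction f rule: word_algebra_induct)
      case zero
      \<comment> \<open>Writing zero as the \<open>0\<close>-fold multiple of a word lets the
        compatibility of \<open>h'\<close> with scalars determine its value.\<close>
      have "cls (0 :: _ \<Rightarrow>\<^sub>0 'k) = cls (scale 0 (mon []))" by simp
      also have "h' \<dots> = \<zero>\<^bsub>B\<^esub>"
        using word[of "[]"] by (subst h'_scale) simp_all
      finally show ?case by simp
    qed (simp_all add: h'_add evaluate_add h'_scale word)
    then show "h' C = h C" by (simp add: f h_cls)
  qed
  ultimately show "\<exists>!h. ?P h" by blast
qed

end

section \<open>The basis of irreducible words\<close>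

context db_ordered_words
begin

abbreviation Irr :: "'k::comm_ring_1 itself \<Rightarrow> ('o + 'o, 'x) bword set" where
  "Irr _ \<equiv> irreducibles \<X> r (S_MS \<X> :: (('o + 'o, 'x) bword \<Rightarrow>\<^sub>0 'k) set)"

text \<open>The leading word of a relation is the same pair of brackets over every ring, so
  irreducibility becomes a purely combinatorial condition: nowhere do two brackets of the same side
  stand next to each other.\<close>

lemma irreducibles_iff:
  "w \<in> Irr TYPE('k::comm_ring_1) \<longleftrightarrow> w \<in> bwords \<X> \<and>
     (\<forall>q\<in>star_words \<X>. \<forall>l m a b. isl l = isl m \<and> a \<in> bwords \<X> \<and> b \<in> bwords \<X> \<longrightarrow>
        w \<noteq> subst q [Bracket l a, Bracket m b])"
proof -
  have eq: "(\<forall>s\<in>S_MS \<X> :: (('o + 'o, 'x) bword \<Rightarrow>\<^sub>0 'k) set. P (lead r s)) \<longleftrightarrow>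
      (\<forall>l m a b. isl l = isl m \<and> a \<in> bwords \<X> \<and> b \<in> bwords \<X> \<longrightarrow> P [Bracket l a, Bracket m b])" for P
  proof (intro iffI allI impI ballI)
    fix l m :: "'o + 'o" and a b :: "('o + 'o, 'x) bword"
    assume P: "\<forall>s\<in>S_MS \<X> :: (('o + 'o, 'x) bword \<Rightarrow>\<^sub>0 'k) set. P (lead r s)"
      and *: "isl l = isl m \<and> a \<in> bwords \<X> \<and> b \<in> bwords \<X>"
    from * P[rule_format, of "rb_relation l m a b"] show "P [Bracket l a, Bracket m b]"
      by (simp add: rb_relation_in_S_MS lead_rb_relation)
  next
    fix s :: "('o + 'o, 'x) bword \<Rightarrow>\<^sub>0 'k"
    assume P: "\<forall>l m a b. isl l = isl m \<and> a \<in> bwords \<X> \<and> b \<in> bwords \<X> \<longrightarrow> P [Bracket l a, Bracket m b]"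
      and "s \<in> S_MS \<X>"
    then obtain l m a b where "s = rb_relation l m a b" "isl l = isl m" "a \<in> bwords \<X>" "b \<in> bwords \<X>"
      unfolding S_MS_eq by blast
    with P show "P (lead r s)" by (simp add: lead_rb_relation)
  qed
  show ?thesis
    by (simp only: irreducibles_def mem_Collect_eq eq[of "\<lambda>v. w \<noteq> subst q v" for q])
qed

text \<open>A context inside the tail, or inside the contents of the head bracket, extends to a
  context of the whole word, so a forbidden pair there, or at the first two factors, is forbidden in
  the whole.\<close>

lemma irreducibles_Cons:
  assumes "p # u \<in> Irr TYPE('k::comm_ring_1)"
  shows "u \<in> Irr TYPE('k)" "p = Bracket l a \<Longrightarrow> a \<in> Irr TYPE('k)"
    "u = p' # v \<Longrightarrow> \<not> interact p p'"
proof -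
  have pu: "p \<in> bprimes \<X>" "u \<in> bwords \<X>"
    and irr: "\<And>q l m a b. q \<in> star_words \<X> \<Longrightarrow> isl l = isl m \<Longrightarrow> a \<in> bwords \<X> \<Longrightarrow> b \<in> bwords \<X> \<Longrightarrow>
      p # u \<noteq> subst q [Bracket l a, Bracket m b]"
    using assms unfolding irreducibles_iff by auto
  have "u \<noteq> subst q [Bracket l a, Bracket m b]"
    if "q \<in> star_words \<X>" "isl l = isl m" "a \<in> bwords \<X>" "b \<in> bwords \<X>" for q l m a b
  proof -
    have "lift_word [p] @ q \<in> star_words \<X>" using that pu by simp
    from irr[OF this that(2-4)] show ?thesis
      by (simp only: subst_simps subst_lift_word append_Cons append_Nil list.inject simp_thms)
  qed
  then show "u \<in> Irr TYPE('k)" using pu unfolding irreducibles_iff by auto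
  show "a \<in> Irr TYPE('k)" if p: "p = Bracket l a"
  proof -
    have "a \<noteq> subst q [Bracket k b, Bracket m c]"
      if "q \<in> star_words \<X>" "isl k = isl m" "b \<in> bwords \<X>" "c \<in> bwords \<X>" for q k m b c
    proof -
      have "[Bracket l q] @ lift_word u \<in> star_words \<X>" using that(1) pu(2) by (intro star_words_intros)
      from irr[OF this that(2-4)] show ?thesis by (simp add: p)
    qed
    then show ?thesis using pu(1) p unfolding irreducibles_iff by auto
  qed
  show "\<not> interact p p'" if "u = p' # v"
  proof
    assume "interact p p'"
    then obtain l m a b where "p = Bracket l a" "p' = Bracket m b" "isl l = isl m"
      by (auto simp: interact_def)
    moreover have "[Letter None] @ lift_word v \<in> star_words \<X>"
      using that pu(2) by (intro star_words_intros) simp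
    ultimately show False
      using irr[of "[Letter None] @ lift_word v" l m a b] that pu by simp
  qed
qed

lemma irreducible_spanning:
  fixes I :: "(('o + 'o, 'x) bword \<Rightarrow>\<^sub>0 'k::comm_ring_1) set"
  assumes "matching_RB_quotient \<X> I" "Poly_Mapping.keys f \<subseteq> bwords \<X>"
  shows "\<exists>g. Poly_Mapping.keys g \<subseteq> Irr TYPE('k) \<and> f - g \<in> I"
proof -
  interpret matching_RB_quotient \<X> I by fact
  have sum: "\<exists>h. Poly_Mapping.keys h \<subseteq> Irr TYPE('k) \<and> (f + g) - h \<in> I"
    if f: "\<exists>h. Poly_Mapping.keys h \<subseteq> Irr TYPE('k) \<and> f - h \<in> I"
      and g: "\<exists>h. Poly_Mapping.keys h \<subseteq> Irr TYPE('k) \<and> g - h \<in> I" for f g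
  proof -
    obtain h h' where h: "Poly_Mapping.keys h \<subseteq> Irr TYPE('k)" "f - h \<in> I"
      "Poly_Mapping.keys h' \<subseteq> Irr TYPE('k)" "g - h' \<in> I" using f g by blast
    have "Poly_Mapping.keys (h + h') \<subseteq> Irr TYPE('k)" using h keys_add[of h h'] by blast
    moreover have "(f + g) - (h + h') \<in> I" using ideal_add[OF h(2,4)] by (simp add: algebra_simps)
    ultimately show ?thesis by blast
  qed
  have word: "\<exists>g. Poly_Mapping.keys g \<subseteq> Irr TYPE('k) \<and> mon w - g \<in> I" if "w \<in> bwords \<X>" for w
    using wf_less that
  proof (induction w rule: wf_induct_rule)
    case (less w)
    show ?case
    proof (cases "w \<in> Irr TYPE('k)")
      case True
      then show ?thesis by (intro exI[of _ "mon w"]) (simp add: ideal_zero)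
    next
      case False
      then obtain q l m a b where q: "q \<in> star_words \<X>" "isl l = isl m" "a \<in> bwords \<X>" "b \<in> bwords \<X>"
        "w = subst q [Bracket l a, Bracket m b]"
        using less.prems unfolding irreducibles_iff by blast
      \<comment> \<open>Modulo the ideal \<open>w\<close> equals the sum of these two words. Both
        are smaller because the comparison inside a relation is preserved by the context
        \<open>q\<close>.\<close>
      define w1 w2 where "w1 = subst q [Bracket m (Bracket (to_R l) a # b)]"
        and "w2 = subst q [Bracket l (a @ [Bracket (to_S m) b])]"
      have "db_less rX rL w1 w" "db_less rX rL w2 w" "w1 \<in> bwords \<X>" "w2 \<in> bwords \<X>"
        unfolding w1_def w2_def q(5) using q
        by (intro db_less_subst[OF q(1)] subst_in_bwords[OF q(1)] less_breadth; simp)+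
      then have "\<exists>g. Poly_Mapping.keys g \<subseteq> Irr TYPE('k) \<and> mon w1 - g \<in> I"
        "\<exists>g. Poly_Mapping.keys g \<subseteq> Irr TYPE('k) \<and> mon w2 - g \<in> I"
        using less.IH by simp_all
      from sum[OF this] obtain g where g: "Poly_Mapping.keys g \<subseteq> Irr TYPE('k)" "mon w1 + mon w2 - g \<in> I"
        by blast
      have "plug q (rb_relation l m a b) \<in> I"
        using ideal_plug[OF q(1)] rb_relation_in_S_MS[OF q(2-4)] S_MS_subset_operated_ideal
        unfolding I_eq by blast
      then have "mon w - mon w1 - mon w2 \<in> I"
        by (simp add: rb_relation_def linear_mapD[OF linear_plug] q(5) w1_def w2_def)
      from ideal_add[OF this g(2)] have "mon w - g \<in> I" by (simp add: algebra_simps)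
      with g(1) show ?thesis by blast
    qed
  qed
  from assms(2) show ?thesis
  proof (induction f rule: word_algebra_induct)
    case zero
    show ?case by (intro exI[of _ 0]) (simp add: ideal_zero)
  next
    case (add f g)
    then show ?case by (intro sum)
  next
    case (mon c u)
    from word[OF mon] obtain g where g: "Poly_Mapping.keys g \<subseteq> Irr TYPE('k)" "mon u - g \<in> I" by blast
    have "Poly_Mapping.keys (scale c g) \<subseteq> Irr TYPE('k)" using g(1) keys_scale[of c g] by blast
    moreover have "scale c (mon u) - scale c g \<in> I"
      using ideal_scale[OF g(2), of c] by (simp add: scale_distrib)
    ultimately show ?case by blast
  qed
qed

lemma irreducible_independent:
  fixes I :: "(('o + 'o, 'x) bword \<Rightarrow>\<^sub>0 'k::comm_ring_1) set"
  assumes "matching_RB_quotient \<X> I" "Poly_Mapping.keys f \<subseteq> Irr TYPE('k)" "f \<in> I"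
  shows "f = 0"
proof -
  interpret matching_RB_quotient \<X> I by fact
  interpret E: matching_RB_evaluation "rb_algebra :: ('k, ('o + 'o, 'x) bword \<Rightarrow>\<^sub>0 'k) module"
    "\<lambda>\<omega>. bracket (Inl \<omega>)" "\<lambda>\<omega>. bracket (Inr \<omega>)" \<X> "\<lambda>x. mon [Letter x]"
    by (intro matching_RB_evaluation.intro rb_algebra_matching_RB_system matching_RB_evaluation_axioms.intro) simp
  have op: "E.opB l = bracket l" for l by (cases l) (auto simp: E.opB_def)
  \<comment> \<open>The head of an irreducible word does not interact with the next factor, so here
    the new product is concatenation. Evaluation multiplies the factors from the right and thus
    rebuilds the word.\<close>
  have Cons: "mon [p] \<diamond> mon u = (mon (p # u) :: _ \<Rightarrow>\<^sub>0 'k)" if "p # u \<in> Irr TYPE('k)" for p u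
  proof (cases u)
    case (Cons p' v)
    with that have "\<not> interact p p'" by (intro irreducibles_Cons(3)) auto
    then have "rb_prod [p] (p' # v) = (mon [p, p'] * mon v :: _ \<Rightarrow>\<^sub>0 'k)"
      by (subst rb_prod_Cons_right) (simp add: rb_prod_concat)
    then show ?thesis by (simp add: Cons)
  qed simp
  have word: "E.eval_word w = mon w" if "w \<in> bwords \<X>" "w \<in> Irr TYPE('k)" for w
    using that
  proof (induction w rule: bword_induct)
    case (Letter x u)
    then show ?case using irreducibles_Cons(1)[OF Letter.prems] Cons[OF Letter.prems] by simp
  next
    case (Bracket l a u)
    then show ?case
      using irreducibles_Cons(1)[OF Bracket.prems] irreducibles_Cons(2)[OF Bracket.prems] Cons[OF Bracket.prems]
      by (simp add: op)
  qed simp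
  have irr_sub: "Irr TYPE('k) \<subseteq> bwords \<X>" by (auto simp: irreducibles_def)
  from assms(2) have "E.evaluate f = f"
  proof (induction f rule: word_algebra_induct)
    case (add f g)
    with irr_sub show ?case by (simp add: E.evaluate_add[OF order_trans order_trans])
  next
    case (mon c u)
    with irr_sub show ?case by (auto simp: word)
  qed simp
  with E.operated_ideal_eval_kernel[of f] assms(3) show "f = 0" by (simp add: I_eq)
qed

lemma irreducible_basis:
  "module_basis (quotient_MS \<X> :: ('k, (('o + 'o, 'x) bword \<Rightarrow>\<^sub>0 'k::comm_ring_1) set) module)
    (Irr TYPE('k)) (word_class \<X>)"
proof -
  define I :: "(('o + 'o, 'x) bword \<Rightarrow>\<^sub>0 'k) set" where "I = operated_ideal \<X> (S_MS \<X>)"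
  interpret matching_RB_quotient \<X> I by unfold_locales (rule I_def)
  have irr_sub: "Irr TYPE('k) \<subseteq> bwords \<X>" by (auto simp: irreducibles_def)
  have sum: "(\<Oplus>\<^bsub>Q\<^esub>w\<in>F. c w \<odot>\<^bsub>Q\<^esub> word_class \<X> w) = cls (\<Sum>w\<in>F. scale (c w) (mon w))"
    if "finite F" "F \<subseteq> Irr TYPE('k)" for F and c :: "_ \<Rightarrow> 'k"
    unfolding word_class_eq Q_simps using that irr_sub by (intro finsum_Q keys_closed(2)) auto
  show ?thesis
    unfolding module_basis_def Q_eq
  proof (intro conjI ballI allI impI)
    show "word_class \<X> \<in> Irr TYPE('k) \<rightarrow> carrier Q"
      using irr_sub by (auto simp: word_class_eq Q_simps)
    fix C assume "C \<in> carrier Q"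
    then obtain f where f: "Poly_Mapping.keys f \<subseteq> bwords \<X>" "C = cls f" by (auto simp: Q_simps)
    from irreducible_spanning[OF matching_RB_quotient_axioms f(1)]
    obtain g where g: "Poly_Mapping.keys g \<subseteq> Irr TYPE('k)" "cls f = cls g" by (auto simp: cls_eq_iff)
    with f sum[OF finite_keys g(1), of "Poly_Mapping.lookup g"]
    show "\<exists>F c. finite F \<and> F \<subseteq> Irr TYPE('k) \<and> C = (\<Oplus>\<^bsub>Q\<^esub>w\<in>F. c w \<odot>\<^bsub>Q\<^esub> word_class \<X> w)"
      by (intro exI[of _ "Poly_Mapping.keys g"] exI[of _ "Poly_Mapping.lookup g"])
        (simp add: word_algebra_expand)
  next
    fix F and c :: "_ \<Rightarrow> 'k" and w
    assume F: "finite F \<and> F \<subseteq> Irr TYPE('k) \<and> (\<Oplus>\<^bsub>Q\<^esub>w\<in>F. c w \<odot>\<^bsub>Q\<^esub> word_class \<X> w) = \<zero>\<^bsub>Q\<^esub>"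
      and w: "w \<in> F"
    \<comment> \<open>The vanishing combination of classes lifts to this element of the ideal, whose
      coefficients at the words of \<open>F\<close> are exactly the values of
      \<open>c\<close>.\<close>
    let ?f = "\<Sum>w\<in>F. scale (c w) (mon w)"
    have lookup: "Poly_Mapping.lookup ?f v = (if v \<in> F then c v else 0)" for v
      using F by (auto simp: lookup_sum lookup_mon if_distrib[of "(*) _"] cong: if_cong)
    have "cls ?f = cls 0" using F sum[of F c] by (simp add: Q_simps)
    then have "?f \<in> I" using cls_eq_iff[of ?f 0] by simp
    moreover have "Poly_Mapping.keys ?f \<subseteq> Irr TYPE('k)"
      using F by (auto simp: in_keys_iff lookup split: if_splits)
    ultimately have "?f = 0" by (intro irreducible_independent[OF matching_RB_quotient_axioms])
    with lookup[of w] w show "c w = 0" by simp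
  qed
qed

end

theorem proposition3p13:
  fixes \<X> :: "'x set"
    and leX :: "'x rel"
    and leOmega :: "('o + 'o) rel"
  assumes "well_order_on \<X> leX"
    and "well_order_on UNIV leOmega"
  shows
    "monomial_order \<X> (db_order \<X> leX leOmega) \<and>
     groebner_shirshov_basis \<X> (db_order \<X> leX leOmega)
       (S_MS \<X> :: (('o + 'o, 'x) bword \<Rightarrow>\<^sub>0 'k::comm_ring_1) set) \<and>
     free_matching_RB_system TYPE('b) \<X> (\<lambda>x. word_class \<X> [Letter x])
       (quotient_MS \<X> :: ('k, (('o + 'o, 'x) bword \<Rightarrow>\<^sub>0 'k) set) module)
       (\<lambda>\<omega>. quotient_op \<X> (Inl \<omega>)) (\<lambda>\<omega>. quotient_op \<X> (Inr \<omega>)) \<and>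
     module_basis (quotient_MS \<X> :: ('k, (('o + 'o, 'x) bword \<Rightarrow>\<^sub>0 'k) set) module)
       (irreducibles \<X> (db_order \<X> leX leOmega)
          (S_MS \<X> :: (('o + 'o, 'x) bword \<Rightarrow>\<^sub>0 'k) set))
       (word_class \<X>)"
proof -
  interpret db_ordered_words \<X> leX leOmega "db_order \<X> leX leOmega"
    by unfold_locales (use assms in auto)
  interpret matching_RB_quotient \<X> "operated_ideal \<X> (S_MS \<X> :: (('o + 'o, 'x) bword \<Rightarrow>\<^sub>0 'k) set)"
    by unfold_locales simp
  show ?thesis
    using monomial groebner_shirshov quotient_free[where 'b = 'b] irreducible_basis[where 'k = 'k]
    by (simp add: Q_eq)
qed

end
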